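(* Suppose that $\beta_1(n)$ has eigenvalues $\pm\kappa_1(n)$, where $2\kappa_1(n)$ is not an integer. Then: (i) there exists $Z_n$, a $2\times1$ real vector solution of $\frac{d}{dx}Z_n(x)=B_n(x)Z_n(x)$, such that $Z_n(x)\to0$ as $x\to\delta_1$; (ii) the integral operator on $L^2((0,1);dx/x)$ with kernel $$K_n(z,\zeta)=\frac{\sqrt{z\zeta}\,Z_n(\zeta)^\dagger JZ_n(z)}{z-\zeta}$$ is of trace class; moreover, there exists a real vector Hankel operator $\Gamma_{\psi_n}$ on $L^2((0,1);dy/y)$ such that $$K_n=\Gamma_{\psi_n}^\dagger\,\sigma\,\Gamma_{\psi_n};$$ (iii) if $\sigma\ge0$, then $K_n\ge0$.
   Context: Let $v(x)=\sum_{j=0}^{2N}a_jx^j$ be a real polynomial with $a_{2N}>0$, and let $\rho$ be its equilibrium measure: the Borel probability measure on $\mathbf{R}$ minimizing $\int v\,d\rho-\iint\log|x-y|\,\rho(dx)\rho(dy)$. Its compact support is $S=\bigcup_{j=1}^{g+1}[\delta_{2j-1},\delta_{2j}]$, where $\delta_1<\delta_2\le\delta_3<\dots<\delta_{2g+2}$. Let $u(z)=\int_S\frac{v'(z)-v'(x)}{z-x}\rho(dx)$; let $\delta_1,\dots,\delta_{4N-2}$ be the zeros of $v'(z)^2-4u(z)$ (the first $2g+2$ being the endpoints of $S$), and let $w(x)=2Na_{2N}\bigl(-\prod_{j=1}^{4N-2}(x-\delta_j)\bigr)^{1/2}$, so that $w^2=4u-v'^2$ and $\rho(dx)=\frac1{2\pi}\mathbf{I}_S(x)w(x)\,dx$.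 Let $p_j$ be the monic orthogonal polynomials for $\rho$ (degree $j$), $h_j=\int_S p_j^2\,d\rho$, and $$Y_n(z)=\begin{bmatrix}p_n(z)&\int_S\frac{p_n(t)\rho(dt)}{z-t}\\ \frac{p_{n-1}(z)}{h_{n-1}}&\frac1{h_{n-1}}\int_S\frac{p_{n-1}(t)\rho(dt)}{z-t}\end{bmatrix},$$ $$A_n(z)=Y_n'(z)Y_n(z)^{-1}+Y_n(z)\begin{bmatrix}0&0\\0&-w'(z)/w(z)\end{bmatrix}Y_n(z)^{-1}=\sum_{j=1}^{4N-2}\frac{\alpha_j(n)}{z-\delta_j}.$$ Let $\nu_j=-\frac12\operatorname{trace}\alpha_j(n)$, $\beta_j(n)=\alpha_j(n)+\nu_jI_2$ (which has zero trace), $B_n(z)=\sum_{j=1}^{4N-2}\frac{\beta_j(n)}{z-\delta_j}$, and $J=\begin{bmatrix}0&-1\\1&0\end{bmatrix}$. For notational simplicity one normalizes $\delta_1=0$ and $1<\delta_2$ (the general case follows by scaling). Each matrix $(\delta_1-\delta_k)J\beta_k(n)$ is real symmetric, hence congruent to one of $$\sigma_k=\pm\begin{bmatrix}1&0\\0&1\end{bmatrix},\ \pm\begin{bmatrix}1&0\\0&0\end{bmatrix},\ \begin{bmatrix}1&0\\0&-1\end{bmatrix},\ \begin{bmatrix}0&0\\0&0\end{bmatrix};$$ $\sigma=\operatorname{diagonal}[\sigma_k]_{k=2}^{4N-2}$ is the block diagonal sum of these. For a continuous $\phi:(0,1)\to\mathbf{R}^{8N-6}$, the (real vector) Hankel operator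 $\Gamma_\phi:L^2((0,1);dy/y;\mathbf{R})\to L^2((0,1);dy/y;\mathbf{R}^{8N-6})$ is $\Gamma_\phi f(x)=\int_0^1\phi(xy)f(y)\frac{dy}{y}$.
   Formalization: All zeros δ_j of v'²−4u are assumed real (for a non-real zero the matrices (δ₁−δ_k)Jβ_k are not all real, so σ is undefined); zeros of the density inside S are counted as touching band endpoints, so no remaining zero lies inside an open band. *)

theory Defs
  imports "HOL-Probability.Probability_Measure" "HOL-Computational_Algebra.Polynomial"
begin

section \<open>Equilibrium measures\<close>

text \<open>
  Probability measures for which both terms of the logarithmic energy are finite.  Every other
  probability measure has energy plus infinity, because a polynomial with positive leading
  coefficient and even degree dominates the logarithm.  As \<^term>\<open>ln (0::real) = 0\<close> here, the
  diagonal, where the logarithmic kernel is infinite, has to be excluded explicitly.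
\<close>

definition finite_log_energy :: "real poly \<Rightarrow> real measure \<Rightarrow> bool" where
  "finite_log_energy v \<rho> \<longleftrightarrow>
     prob_space \<rho> \<and> sets \<rho> = sets borel \<and>
     integrable \<rho> (poly v) \<and>
     (AE z in \<rho> \<Otimes>\<^sub>M \<rho>. fst z \<noteq> snd z) \<and>
     integrable (\<rho> \<Otimes>\<^sub>M \<rho>) (\<lambda>z. ln \<bar>fst z - snd z\<bar>)"

definition log_energy :: "real poly \<Rightarrow> real measure \<Rightarrow> real" where
  "log_energy v \<rho> = (LINT x|\<rho>. poly v x) - (LINT x|\<rho>. LINT y|\<rho>. ln \<bar>x - y\<bar>)"

definition equilibrium_measure :: "real poly \<Rightarrow> real measure \<Rightarrow> bool" where
  "equilibrium_measure v \<rho> \<longleftrightarrow>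
     finite_log_energy v \<rho> \<and>
     (\<forall>\<mu>. finite_log_energy v \<mu> \<longrightarrow> log_energy v \<rho> \<le> log_energy v \<mu>)"

definition msupport :: "real measure \<Rightarrow> real set" where
  "msupport \<rho> = {x. \<forall>e>0. measure \<rho> (ball x e) > 0}"

text \<open>The integrand below is junk only at \<open>x = z\<close>, a null set as equilibrium measures have no atoms.\<close>

definition u_fun :: "real poly \<Rightarrow> real measure \<Rightarrow> real \<Rightarrow> real" where
  "u_fun v \<rho> z = (LINT x|\<rho>. (poly (pderiv v) z - poly (pderiv v) x) / (z - x))"

definition w_fun :: "nat \<Rightarrow> real poly \<Rightarrow> (nat \<Rightarrow> real) \<Rightarrow> real \<Rightarrow> real" where
  "w_fun N v \<delta> x = 2 * real N * lead_coeff v * sqrt (- (\<Prod>j=1..4*N-2. (x - \<delta> j)))"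

text \<open>
  The square of \<^const>\<open>w_fun\<close> as a polynomial function on the complex plane.  The logarithmic
  derivative of \<open>w\<close> off the real line is \<open>(w\<^sup>2)' / (2 w\<^sup>2)\<close> for every branch of the root.
\<close>

definition w_sq :: "nat \<Rightarrow> real poly \<Rightarrow> (nat \<Rightarrow> real) \<Rightarrow> complex \<Rightarrow> complex" where
  "w_sq N v \<delta> z =
     - (of_real (2 * real N * lead_coeff v))\<^sup>2 * (\<Prod>j=1..4*N-2. (z - of_real (\<delta> j)))"

definition w_logderiv :: "nat \<Rightarrow> real poly \<Rightarrow> (nat \<Rightarrow> real) \<Rightarrow> complex \<Rightarrow> complex" where
  "w_logderiv N v \<delta> z = deriv (w_sq N v \<delta>) z / (2 * w_sq N v \<delta> z)"

section \<open>Orthogonal polynomials and the matrices of the system\<close>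

definition monic_orthogonal :: "real measure \<Rightarrow> (nat \<Rightarrow> real poly) \<Rightarrow> bool" where
  "monic_orthogonal \<rho> p \<longleftrightarrow>
     (\<forall>j. degree (p j) = j \<and> lead_coeff (p j) = 1) \<and>
     (\<forall>i j. i \<noteq> j \<longrightarrow> (LINT x|\<rho>. poly (p i) x * poly (p j) x) = 0)"

definition sqnorm :: "real measure \<Rightarrow> (nat \<Rightarrow> real poly) \<Rightarrow> nat \<Rightarrow> real" where
  "sqnorm \<rho> p j = (LINT x|\<rho>. (poly (p j) x)\<^sup>2)"

definition cauchy_int :: "real measure \<Rightarrow> real poly \<Rightarrow> complex \<Rightarrow> complex" where
  "cauchy_int \<rho> q z = (LINT t|\<rho>. of_real (poly q t) / (z - of_real t))"

definition mat22 :: "'a::zero \<Rightarrow> 'a \<Rightarrow> 'a \<Rightarrow> 'a \<Rightarrow> 'a^2^2" where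
  "mat22 a b c d = vector [vector [a, b], vector [c, d]]"

definition J :: "real^2^2" where
  "J = mat22 0 (-1) 1 0"

definition Y_mat :: "real measure \<Rightarrow> (nat \<Rightarrow> real poly) \<Rightarrow> nat \<Rightarrow> complex \<Rightarrow> complex^2^2" where
  "Y_mat \<rho> p n z =
     mat22 (poly (map_poly of_real (p n)) z)
           (cauchy_int \<rho> (p n) z)
           (poly (map_poly of_real (p (n-1))) z / of_real (sqnorm \<rho> p (n-1)))
           (1 / of_real (sqnorm \<rho> p (n-1)) * cauchy_int \<rho> (p (n-1)) z)"

definition mat_deriv :: "(complex \<Rightarrow> complex^2^2) \<Rightarrow> complex \<Rightarrow> complex^2^2" where
  "mat_deriv F z = (\<chi> i l. deriv (\<lambda>s. F s $ i $ l) z)"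

definition A_mat ::
  "nat \<Rightarrow> real poly \<Rightarrow> real measure \<Rightarrow> (nat \<Rightarrow> real) \<Rightarrow> (nat \<Rightarrow> real poly) \<Rightarrow> nat \<Rightarrow> complex \<Rightarrow> complex^2^2"
  where
  "A_mat N v \<rho> \<delta> p n z =
     mat_deriv (Y_mat \<rho> p n) z ** matrix_inv (Y_mat \<rho> p n z)
     + Y_mat \<rho> p n z ** mat22 0 0 0 (- w_logderiv N v \<delta> z) ** matrix_inv (Y_mat \<rho> p n z)"

text \<open>
  Equality holds off the support and the poles.  For repeated \<open>\<delta> j\<close> only the sum of the
  corresponding \<open>\<alpha> j\<close> is determined, and any splitting of it is admitted.
\<close>

definition residue_matrices ::
  "nat \<Rightarrow> real poly \<Rightarrow> real measure \<Rightarrow> (nat \<Rightarrow> real) \<Rightarrow> (nat \<Rightarrow> real poly) \<Rightarrow> nat \<Rightarrow> (nat \<Rightarrow> real^2^2) \<Rightarrow> bool"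
  where
  "residue_matrices N v \<rho> \<delta> p n \<alpha> \<longleftrightarrow>
     (\<forall>z. z \<notin> complex_of_real ` (msupport \<rho> \<union> \<delta> ` {1..4*N-2}) \<longrightarrow>
        A_mat N v \<rho> \<delta> p n z =
          (\<chi> i l. \<Sum>j=1..4*N-2. of_real (\<alpha> j $ i $ l) / (z - of_real (\<delta> j))))"

definition traceless :: "real^2^2 \<Rightarrow> real^2^2" where
  "traceless a = a + mat (- (1/2) * trace a)"

definition B_mat :: "nat \<Rightarrow> (nat \<Rightarrow> real) \<Rightarrow> (nat \<Rightarrow> real^2^2) \<Rightarrow> real \<Rightarrow> real^2^2" where
  "B_mat N \<delta> \<beta> x = (\<Sum>j=1..4*N-2. (1 / (x - \<delta> j)) *\<^sub>R \<beta> j)"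

definition complex_eigenvalues :: "real^2^2 \<Rightarrow> complex set" where
  "complex_eigenvalues A =
     {l. \<exists>x. x \<noteq> 0 \<and> (\<chi> i k. complex_of_real (A $ i $ k)) *v x = l *s x}"

definition congruence_normal_forms :: "(real^2^2) set" where
  "congruence_normal_forms =
     {mat22 1 0 0 1, - mat22 1 0 0 1, mat22 1 0 0 0, - mat22 1 0 0 0, mat22 1 0 0 (-1), mat22 0 0 0 0}"

definition congruent_mat :: "real^2^2 \<Rightarrow> real^2^2 \<Rightarrow> bool" where
  "congruent_mat M D \<longleftrightarrow> (\<exists>C. invertible C \<and> M = transpose C ** D ** C)"

section \<open>Operators between real square-integrable functions\<close>

definition L2_space :: "'a measure \<Rightarrow> ('a \<Rightarrow> 'b::euclidean_space) set" where
  "L2_space M = {f. f \<in> borel_measurable M \<and> integrable M (\<lambda>x. (norm (f x))\<^sup>2)}"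

definition L2_inner :: "'a measure \<Rightarrow> ('a \<Rightarrow> 'b::euclidean_space) \<Rightarrow> ('a \<Rightarrow> 'b) \<Rightarrow> real" where
  "L2_inner M f g = (LINT x|M. f x \<bullet> g x)"

definition L2_nrm :: "'a measure \<Rightarrow> ('a \<Rightarrow> 'b::euclidean_space) \<Rightarrow> real" where
  "L2_nrm M f = sqrt (L2_inner M f f)"

text \<open>
  With \<open>I\<close> finite, a family \<open>F :: nat \<Rightarrow> 'a \<Rightarrow> real^2\<close> restricted to \<open>I\<close> represents a function
  with values in the orthogonal sum of \<open>card I\<close> copies of \<open>real^2\<close>.
\<close>

definition L2_blocks :: "nat set \<Rightarrow> 'a measure \<Rightarrow> (nat \<Rightarrow> 'a \<Rightarrow> real^2) set" where
  "L2_blocks I M = {F. \<forall>k\<in>I. F k \<in> L2_space M}"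

definition L2_blocks_inner ::
  "nat set \<Rightarrow> 'a measure \<Rightarrow> (nat \<Rightarrow> 'a \<Rightarrow> real^2) \<Rightarrow> (nat \<Rightarrow> 'a \<Rightarrow> real^2) \<Rightarrow> real" where
  "L2_blocks_inner I M F G = (\<Sum>k\<in>I. L2_inner M (F k) (G k))"

definition kernel_op :: "'a measure \<Rightarrow> ('a \<Rightarrow> 'a \<Rightarrow> real) \<Rightarrow> ('a \<Rightarrow> real) \<Rightarrow> 'a \<Rightarrow> real" where
  "kernel_op M K f x = (LINT y|M. K x y * f y)"

definition bounded_kernel_op :: "'a measure \<Rightarrow> ('a \<Rightarrow> 'a \<Rightarrow> real) \<Rightarrow> bool" where
  "bounded_kernel_op M K \<longleftrightarrow>
     (\<lambda>z. K (fst z) (snd z)) \<in> borel_measurable (M \<Otimes>\<^sub>M M) \<and>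
     (\<exists>C. \<forall>f\<in>L2_space M.
        (AE x in M. integrable M (\<lambda>y. K x y * f y)) \<and>
        kernel_op M K f \<in> L2_space M \<and>
        L2_nrm M (kernel_op M K f) \<le> C * L2_nrm M f)"

text \<open>
  Trace class operators in the form of nuclear operators on a Hilbert space: those that are sums
  of rank one operators \<open>f \<mapsto> \<langle>a\<^sub>i, f\<rangle> b\<^sub>i\<close> with summable operator norms.
\<close>

definition trace_class :: "'a measure \<Rightarrow> (('a \<Rightarrow> real) \<Rightarrow> 'a \<Rightarrow> real) \<Rightarrow> bool" where
  "trace_class M T \<longleftrightarrow>
     (\<exists>a b :: nat \<Rightarrow> 'a \<Rightarrow> real.
        (\<forall>i. a i \<in> L2_space M \<and> b i \<in> L2_space M) \<and>
        summable (\<lambda>i. L2_nrm M (a i) * L2_nrm M (b i)) \<and>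
        (\<forall>f\<in>L2_space M. T f \<in> L2_space M \<and>
           (\<lambda>m. L2_nrm M (\<lambda>x. T f x - (\<Sum>i<m. L2_inner M (a i) f * b i x))) \<longlonglongrightarrow> 0))"

definition nonneg_operator :: "'a measure \<Rightarrow> (('a \<Rightarrow> real) \<Rightarrow> 'a \<Rightarrow> real) \<Rightarrow> bool" where
  "nonneg_operator M T \<longleftrightarrow>
     (\<forall>f\<in>L2_space M. \<forall>g\<in>L2_space M. L2_inner M (T f) g = L2_inner M f (T g)) \<and>
     (\<forall>f\<in>L2_space M. 0 \<le> L2_inner M (T f) f)"

definition nonneg_block_diag :: "nat set \<Rightarrow> (nat \<Rightarrow> real^2^2) \<Rightarrow> bool" where
  "nonneg_block_diag I \<sigma> \<longleftrightarrow>
     (\<forall>\<xi> :: nat \<Rightarrow> real^2. 0 \<le> (\<Sum>k\<in>I. \<xi> k \<bullet> (\<sigma> k *v \<xi> k)))"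

definition mult_haar :: "real measure" where
  "mult_haar = density (restrict_space lborel {0<..<1}) (\<lambda>x. ennreal (1 / x))"

definition hankel :: "(nat \<Rightarrow> real \<Rightarrow> real^2) \<Rightarrow> (real \<Rightarrow> real) \<Rightarrow> nat \<Rightarrow> real \<Rightarrow> real^2" where
  "hankel \<phi> f k x = (LINT y|mult_haar. f y *\<^sub>R \<phi> k (x * y))"

definition hankel_operator :: "nat set \<Rightarrow> (nat \<Rightarrow> real \<Rightarrow> real^2) \<Rightarrow> bool" where
  "hankel_operator I \<phi> \<longleftrightarrow>
     (\<forall>k\<in>I. continuous_on {0<..<1} (\<phi> k)) \<and>
     (\<exists>C. \<forall>f\<in>L2_space mult_haar.
        (\<forall>k\<in>I. AE x in mult_haar. integrable mult_haar (\<lambda>y. f y *\<^sub>R \<phi> k (x * y))) \<and>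
        hankel \<phi> f \<in> L2_blocks I mult_haar \<and>
        sqrt (L2_blocks_inner I mult_haar (hankel \<phi> f) (hankel \<phi> f)) \<le> C * L2_nrm mult_haar f)"

definition is_adjoint ::
  "nat set \<Rightarrow> 'a measure \<Rightarrow> (('a \<Rightarrow> real) \<Rightarrow> nat \<Rightarrow> 'a \<Rightarrow> real^2) \<Rightarrow>
   ((nat \<Rightarrow> 'a \<Rightarrow> real^2) \<Rightarrow> 'a \<Rightarrow> real) \<Rightarrow> bool" where
  "is_adjoint I M T T' \<longleftrightarrow>
     (\<forall>F\<in>L2_blocks I M. T' F \<in> L2_space M \<and>
        (\<forall>f\<in>L2_space M. L2_blocks_inner I M (T f) F = L2_inner M f (T' F)))"

definition K_kernel :: "(real \<Rightarrow> real^2) \<Rightarrow> real \<Rightarrow> real \<Rightarrow> real" where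
  "K_kernel Z z \<zeta> = sqrt (z * \<zeta>) * (Z \<zeta> \<bullet> (J *v Z z)) / (z - \<zeta>)"

end

theory Submission
  imports Defs
begin

text \<open>
  The solution \<open>Z\<close> can be written down. Put \<open>q = (p\<^sub>n, p\<^sub>n\<^sub>-\<^sub>1 / h\<^sub>n\<^sub>-\<^sub>1)\<close>, the first column of \<open>Y\<^sub>n\<close>.
  The diagonal term in \<open>A\<^sub>n\<close> acts on the second column only, so \<open>q' = A\<^sub>n q\<close>
  (\<open>first_column_equation\<close>). The determinant of \<open>Y\<^sub>n\<close> is 1, by orthogonality
  (\<open>Cauchy_transform_Wronskian\<close>), so \<open>trace A\<^sub>n = - w' / w\<close>
  (\<open>residue_trace_sum\<close>) and removing the traces of the residues changes \<open>A\<^sub>n\<close> into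
  \<open>B\<^sub>n = A\<^sub>n + (w' / 2 w) I\<close>. Hence \<open>Z = \<bar>w\<bar>\<^sup>1\<^sup>/\<^sup>2 q\<close> solves \<open>Z' = B\<^sub>n Z\<close> on the first band
  (\<open>wave_solution_derivative\<close>), and it vanishes at \<open>\<delta>\<^sub>1\<close> because \<open>w\<close> does. The
  identities for \<open>A\<^sub>n q\<close> and \<open>trace A\<^sub>n\<close> are first shown off the real line, where the Cauchy
  transforms are holomorphic. They only involve rational functions, so they extend by continuity
  to the real points that are not poles.

  Since \<open>Z\<close> is a scalar function times a polynomial vector, \<open>Z(\<zeta>)\<^sup>\<dagger> J Z(z) / (z - \<zeta>)\<close> is
  \<open>\<bar>w(z)\<bar>\<^sup>1\<^sup>/\<^sup>2 \<bar>w(\<zeta>)\<bar>\<^sup>1\<^sup>/\<^sup>2\<close> times a polynomial in both variables, of Christoffel-Darboux type. So the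
  operator \<open>K\<^sub>n\<close> has finite rank, and is of trace class (\<open>K_kernel_trace_class\<close>).

  The factorization comes from differentiating the kernel along rays: by the equation for \<open>Z\<close>, the
  derivative of \<open>t \<mapsto> K\<^sub>n(t x, t y)\<close> is \<open>1 / t\<close> times
  \<open>\<Sum>\<^sub>k \<langle>\<sigma>\<^sub>k \<psi>\<^sub>k(t y), \<psi>\<^sub>k(t x)\<rangle>\<close> with \<open>\<psi>\<^sub>k(x) = \<surd>x C\<^sub>k Z(x) / (x - \<delta>\<^sub>k)\<close>, where \<open>C\<^sub>k\<close> carries
  \<open>(\<delta>\<^sub>1 - \<delta>\<^sub>k) J \<beta>\<^sub>k\<close> to its normal form (\<open>kernel_ray_derivative\<close>). Integration over \<open>0 < t < 1\<close>
  expresses \<open>K\<^sub>n\<close> through the symbols \<open>\<psi>\<^sub>k\<close>, as the boundary term at \<open>t = 0\<close> vanishes, and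
  Fubini's theorem reads the result as \<open>\<Gamma>\<^sup>\<dagger> \<sigma> \<Gamma>\<close> (\<open>kernel_op_eq_hankel_product\<close>). The analytic side
  conditions all follow from one estimate: each kernel involved is bounded by a constant times the
  rank one kernel \<open>\<surd>x \<surd>y\<close>, and \<open>\<surd>\<close> is square integrable for \<open>dx / x\<close> on \<open>(0, 1)\<close>. Positivity
  of \<open>K\<^sub>n\<close> for \<open>\<sigma> \<ge> 0\<close> is then read off from the factorization.
\<close>

section \<open>Two by two matrices\<close>

lemma mat22_nth [simp]:
  "mat22 a b c d $ 1 $ 1 = a" "mat22 a b c d $ 1 $ 2 = b"
  "mat22 a b c d $ 2 $ 1 = c" "mat22 a b c d $ 2 $ 2 = d"
  by (simp_all add: mat22_def)

lemma matrix_mult_22: "((A :: 'a::semiring_1^2^2) ** B) $ i $ j = A $ i $ 1 * B $ 1 $ j + A $ i $ 2 * B $ 2 $ j"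
  by (simp add: matrix_matrix_mult_def sum_2)

lemma matrix_vector_mult_22: "((A :: 'a::semiring_1^2^2) *v x) $ i = A $ i $ 1 * x $ 1 + A $ i $ 2 * x $ 2"
  by (simp add: matrix_vector_mult_def sum_2)

lemma matrix_inv_left_det:
  fixes Y :: "'a::field^'n^'n"
  assumes "det Y \<noteq> 0"
  shows "matrix_inv Y ** Y = mat 1"
proof -
  have "\<exists>X. Y ** X = mat 1 \<and> X ** Y = mat 1"
    using assms invertible_det_nz[of Y] by (simp add: invertible_def)
  then show ?thesis unfolding matrix_inv_def by (rule someI2_ex) blast
qed

section \<open>Orthogonal polynomials\<close>

text \<open>The coefficient of \<open>t\<^sup>j\<close> in the polynomial \<open>(P z - P t) / (z - t)\<close>; it is a polynomial in \<open>z\<close>.\<close>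

definition diff_quot_coeff :: "'a::comm_ring_1 poly \<Rightarrow> 'a \<Rightarrow> nat \<Rightarrow> 'a" where
  "diff_quot_coeff P z j = (\<Sum>k = Suc j..degree P. coeff P k * z ^ (k - Suc j))"

lemma poly_diff_eq_diff_quot:
  "poly P z - poly P t = (z - t) * (\<Sum>j<degree P. diff_quot_coeff P z j * t ^ j)"
proof -
  have "poly P t - poly P z = (t - z) * (\<Sum>j<degree P. diff_quot_coeff P z j * t ^ j)"
    by (simp add: poly_altdef sub_polyfun diff_quot_coeff_def sum_distrib_right)
  then show ?thesis by (metis minus_diff_eq minus_mult_left)
qed

lemma poly_map_of_real: "poly (map_poly complex_of_real q) (of_real t) = of_real (poly q t)"
  by (induction q) (auto simp: map_poly_pCons)

lemma diff_quot_coeff_top: "0 < degree P \<Longrightarrow> diff_quot_coeff P z (degree P - 1) = lead_coeff P"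
  by (simp add: diff_quot_coeff_def)

lemma integrable_continuous_bounded_support:
  fixes f :: "real \<Rightarrow> 'b::euclidean_space"
  assumes \<rho>: "prob_space \<rho>" "sets \<rho> = sets borel" "AE x in \<rho>. \<bar>x\<bar> \<le> R"
    and f: "continuous_on UNIV f"
  shows "integrable \<rho> f"
proof -
  interpret prob_space \<rho> by fact
  have "bounded (f ` cball 0 R)"
    by (intro compact_imp_bounded compact_continuous_image continuous_on_subset[OF f]) auto
  then obtain B where "\<forall>x\<in>cball 0 R. norm (f x) \<le> B"
    by (auto simp: bounded_iff)
  then have B: "norm (f x) \<le> B" if "\<bar>x\<bar> \<le> R" for x
    using that by (simp add: dist_norm)
  have "f \<in> borel_measurable \<rho>"
    unfolding measurable_cong_sets[OF \<rho>(2) refl] by (rule borel_measurable_continuous_onI[OF f])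
  moreover have "AE x in \<rho>. norm (f x) \<le> B"
    using \<rho>(3) by eventually_elim (rule B)
  ultimately show ?thesis by (intro integrable_const_bound)
qed

context
  fixes \<rho> :: "real measure" and p :: "nat \<Rightarrow> real poly" and R :: real
  assumes \<rho>: "prob_space \<rho>" "sets \<rho> = sets borel" "AE x in \<rho>. \<bar>x\<bar> \<le> R"
    and orth: "monic_orthogonal \<rho> p"
begin

lemmas integrable_\<rho> = integrable_continuous_bounded_support[OF \<rho>]

lemma p_degree: "degree (p j) = j"
  using orth by (simp add: monic_orthogonal_def)

lemma p_monic: "coeff (p j) j = 1"
  using orth p_degree[of j] unfolding monic_orthogonal_def by metis

text \<open>
  The induction removes the coefficient at \<open>m\<close> with a multiple of \<^term>\<open>p m\<close>. Bounding the
  coefficients instead of the degree lets it start at the zero polynomial.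
\<close>

lemma orthogonal_lower_degree:
  assumes "m \<le> n" "\<And>i. m \<le> i \<Longrightarrow> coeff q i = 0"
  shows "(LINT x|\<rho>. poly q x * poly (p n) x) = 0"
  using assms
proof (induction m arbitrary: q)
  case 0
  then have "q = 0" by (intro poly_eqI) simp
  then show ?case by simp
next
  case (Suc m)
  define r where "r = q - smult (coeff q m) (p m)"
  have "coeff r i = 0" if "m \<le> i" for i
  proof (cases "i = m")
    case True then show ?thesis by (simp add: r_def p_monic)
  next
    case False
    then have "coeff (p m) i = 0" "coeff q i = 0"
      using that Suc.prems by (auto intro: coeff_eq_0 simp: p_degree)
    then show ?thesis by (simp add: r_def)
  qed
  then have r: "(LINT x|\<rho>. poly r x * poly (p n) x) = 0" using Suc by simp
  have pm: "(LINT x|\<rho>. poly (p m) x * poly (p n) x) = 0"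
    using orth Suc.prems(1) by (simp add: monic_orthogonal_def)
  have "(\<lambda>x. poly q x * poly (p n) x)
      = (\<lambda>x. poly r x * poly (p n) x + coeff q m * (poly (p m) x * poly (p n) x))"
    by (simp add: r_def algebra_simps)
  then have "(LINT x|\<rho>. poly q x * poly (p n) x)
      = (LINT x|\<rho>. poly r x * poly (p n) x + coeff q m * (poly (p m) x * poly (p n) x))" by simp
  also have "\<dots> = (LINT x|\<rho>. poly r x * poly (p n) x)
      + (LINT x|\<rho>. coeff q m * (poly (p m) x * poly (p n) x))"
    by (intro Bochner_Integration.integral_add integrable_\<rho> continuous_intros)
  finally show ?case using r pm by simp
qed

lemma moment_lower: "j < n \<Longrightarrow> (LINT x|\<rho>. x ^ j * poly (p n) x) = 0"
  using orthogonal_lower_degree[of n n "monom 1 j"] by (simp add: poly_monom)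

lemma moment_top: "(LINT x|\<rho>. x ^ n * poly (p n) x) = sqnorm \<rho> p n"
proof -
  have "coeff (monom 1 n - p n) i = 0" if "n \<le> i" for i
    using that p_monic[of n] coeff_eq_0[of "p n" i] by (cases "i = n") (auto simp: p_degree)
  then have "(LINT x|\<rho>. poly (monom 1 n - p n) x * poly (p n) x) = 0"
    by (rule orthogonal_lower_degree[OF order_refl])
  then have "(LINT x|\<rho>. x ^ n * poly (p n) x - (poly (p n) x)\<^sup>2) = 0"
    by (simp add: poly_monom left_diff_distrib power2_eq_square)
  also have "(LINT x|\<rho>. x ^ n * poly (p n) x - (poly (p n) x)\<^sup>2)
      = (LINT x|\<rho>. x ^ n * poly (p n) x) - (LINT x|\<rho>. (poly (p n) x)\<^sup>2)"
    by (intro Bochner_Integration.integral_diff integrable_\<rho> continuous_intros)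
  finally show ?thesis by (simp add: sqnorm_def)
qed

text \<open>A measure without atoms cannot be carried by the finitely many zeros of a polynomial.\<close>

lemma sqnorm_pos:
  assumes null: "\<And>F. finite F \<Longrightarrow> emeasure \<rho> F = 0"
  shows "0 < sqnorm \<rho> p n"
proof -
  interpret prob_space \<rho> by (rule \<rho>)
  have "0 \<le> sqnorm \<rho> p n" by (simp add: sqnorm_def)
  moreover have "sqnorm \<rho> p n \<noteq> 0"
  proof
    assume "sqnorm \<rho> p n = 0"
    moreover have "integrable \<rho> (\<lambda>x. (poly (p n) x)\<^sup>2)" by (intro integrable_\<rho> continuous_intros)
    ultimately have "AE x in \<rho>. poly (p n) x = 0"
      by (simp add: sqnorm_def integral_nonneg_eq_0_iff_AE)
    moreover have "p n \<noteq> 0" using p_monic[of n] by auto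
    then have fin: "finite {x. poly (p n) x = 0}" by (rule poly_roots_finite)
    then have "{x. poly (p n) x = 0} \<in> null_sets \<rho>"
      using null[OF fin] \<rho>(2) by (auto simp: null_sets_def intro: borel_closed finite_imp_closed)
    then have "AE x in \<rho>. x \<notin> {x. poly (p n) x = 0}" by (rule AE_not_in)
    ultimately have "AE x in \<rho>. False" by eventually_elim simp
    then show False by simp
  qed
  ultimately show ?thesis by simp
qed

lemma complex_moment:
  "(LINT t|\<rho>. c * of_real t ^ j * of_real (poly q t)) = c * complex_of_real (LINT t|\<rho>. t ^ j * poly q t)"
proof -
  have "(\<lambda>t. c * of_real t ^ j * complex_of_real (poly q t)) = (\<lambda>t. c * complex_of_real (t ^ j * poly q t))"
    by (simp add: mult.assoc)
  then show ?thesis by (simp only: integral_mult_right_zero integral_complex_of_real)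
qed

lemma continuous_Cauchy_kernel:
  assumes "Im z \<noteq> 0"
  shows "continuous_on UNIV (\<lambda>t. complex_of_real (poly q t) / (z - of_real t))"
  using assms by (intro continuous_intros) (auto simp: complex_eq_iff)

lemma integral_diff_quot:
  fixes P :: "complex poly"
  shows "(LINT t|\<rho>. (\<Sum>j<m. diff_quot_coeff P z j * of_real t ^ j) * of_real (poly q t))
    = (\<Sum>j<m. diff_quot_coeff P z j * complex_of_real (LINT t|\<rho>. t ^ j * poly q t))"
  unfolding sum_distrib_right
  by (subst Bochner_Integration.integral_sum)
    (auto simp: complex_moment intro!: integrable_\<rho> continuous_intros)

text \<open>
  On the left stands the integral of \<open>(p\<^sub>n(z) p\<^sub>n\<^sub>-\<^sub>1(t) - p\<^sub>n\<^sub>-\<^sub>1(z) p\<^sub>n(t)) / (z - t)\<close> over \<open>t\<close>. The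
  numerator is divisible by \<open>z - t\<close>, and after the division orthogonality leaves only the leading
  term of \<open>(p\<^sub>n(z) - p\<^sub>n(t)) / (z - t)\<close>, which pairs with \<open>p\<^sub>n\<^sub>-\<^sub>1\<close> to its squared norm.
\<close>

lemma Cauchy_transform_Wronskian:
  assumes n: "1 \<le> n" and z: "Im z \<noteq> 0"
  shows "poly (map_poly of_real (p n)) z * cauchy_int \<rho> (p (n-1)) z
    - poly (map_poly of_real (p (n-1))) z * cauchy_int \<rho> (p n) z = of_real (sqnorm \<rho> p (n-1))"
proof -
  let ?P = "map_poly complex_of_real (p n)" and ?Q = "map_poly complex_of_real (p (n-1))"
  let ?S = "\<lambda>m F t. (\<Sum>j<m. diff_quot_coeff F z j * complex_of_real t ^ j)"
  have deg: "degree ?P = n" "degree ?Q = n - 1" by (simp_all add: degree_map_poly p_degree)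
  have "poly ?P z * (of_real (poly (p (n-1)) t) / (z - of_real t))
      - poly ?Q z * (of_real (poly (p n) t) / (z - of_real t))
      = ?S n ?P t * of_real (poly (p (n-1)) t) - ?S (n-1) ?Q t * of_real (poly (p n) t)" for t
  proof -
    have nz: "z - of_real t \<noteq> 0" using z by (auto simp: complex_eq_iff)
    have P: "poly ?P z = of_real (poly (p n) t) + (z - of_real t) * ?S n ?P t"
      using poly_diff_eq_diff_quot[of ?P z "of_real t"]
      by (simp only: deg poly_map_of_real diff_eq_eq add.commute)
    have Q: "poly ?Q z = of_real (poly (p (n-1)) t) + (z - of_real t) * ?S (n-1) ?Q t"
      using poly_diff_eq_diff_quot[of ?Q z "of_real t"]
      by (simp only: deg poly_map_of_real diff_eq_eq add.commute)
    have "(a + d * S) * (b / d) - (b + d * T) * (a / d) = S * b - T * a"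
      if "d \<noteq> 0" for a b d S T :: complex using that by (simp add: field_simps)
    from this[OF nz] show ?thesis unfolding P Q by (simp only: add.commute)
  qed
  then have "(LINT t|\<rho>. poly ?P z * (of_real (poly (p (n-1)) t) / (z - of_real t))
      - poly ?Q z * (of_real (poly (p n) t) / (z - of_real t)))
    = (LINT t|\<rho>. ?S n ?P t * of_real (poly (p (n-1)) t) - ?S (n-1) ?Q t * of_real (poly (p n) t))"
    by simp
  moreover have "(LINT t|\<rho>. poly ?P z * (of_real (poly (p (n-1)) t) / (z - of_real t))
      - poly ?Q z * (of_real (poly (p n) t) / (z - of_real t)))
    = poly ?P z * cauchy_int \<rho> (p (n-1)) z - poly ?Q z * cauchy_int \<rho> (p n) z"
    unfolding cauchy_int_def
    by (simp only: Bochner_Integration.integral_diff[OF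
          integrable_mult_right[OF integrable_\<rho>[OF continuous_Cauchy_kernel[OF z]]]
          integrable_mult_right[OF integrable_\<rho>[OF continuous_Cauchy_kernel[OF z]]]]
        integral_mult_right_zero)
  moreover have "(LINT t|\<rho>. ?S n ?P t * of_real (poly (p (n-1)) t) - ?S (n-1) ?Q t * of_real (poly (p n) t))
    = (\<Sum>j<n. diff_quot_coeff ?P z j * of_real (LINT t|\<rho>. t ^ j * poly (p (n-1)) t))
      - (\<Sum>j<n-1. diff_quot_coeff ?Q z j * of_real (LINT t|\<rho>. t ^ j * poly (p n) t))"
    by (subst Bochner_Integration.integral_diff)
      (auto simp: integral_diff_quot intro!: integrable_\<rho> continuous_intros)
  moreover have "(\<Sum>j<n-1. diff_quot_coeff ?Q z j * of_real (LINT t|\<rho>. t ^ j * poly (p n) t)) = 0"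
    by (rule sum.neutral) (auto simp: moment_lower)
  moreover have "(\<Sum>j<n. diff_quot_coeff ?P z j * of_real (LINT t|\<rho>. t ^ j * poly (p (n-1)) t))
    = of_real (sqnorm \<rho> p (n-1))"
  proof -
    have "(\<Sum>j<Suc (n-1). diff_quot_coeff ?P z j * complex_of_real (LINT t|\<rho>. t ^ j * poly (p (n-1)) t))
      = diff_quot_coeff ?P z (n-1) * complex_of_real (LINT t|\<rho>. t ^ (n-1) * poly (p (n-1)) t)"
      unfolding sum.lessThan_Suc by (auto intro!: sum.neutral simp: moment_lower)
    moreover have "diff_quot_coeff ?P z (n-1) = 1"
      using diff_quot_coeff_top[of ?P z] n by (simp add: deg coeff_map_poly p_monic)
    ultimately show ?thesis using n by (simp add: moment_top)
  qed
  ultimately show ?thesis by simp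
qed

text \<open>
  The difference quotient at \<open>z\<close> minus its expected limit is the integral of
  \<open>(w - z) q(t) / ((w - t) (z - t)\<^sup>2)\<close>. Off the real line the denominator is bounded below, by half
  the cube of \<open>\<bar>Im z\<bar>\<close> when \<open>w\<close> is close to \<open>z\<close>, so the error is of order \<open>\<bar>w - z\<bar>\<close>.
\<close>

lemma cauchy_int_differentiable:
  assumes z: "Im z \<noteq> 0"
  shows "cauchy_int \<rho> q field_differentiable at z"
proof -
  let ?\<eta> = "\<bar>Im z\<bar>"
  let ?D = "LINT t|\<rho>. - (of_real (poly q t) / (z - of_real t)\<^sup>2)"
  let ?N = "LINT t|\<rho>. \<bar>poly q t\<bar> * (2 / ?\<eta> ^ 3)"
  have nz: "w - of_real t \<noteq> 0" if "Im w \<noteq> 0" for w t using that by (auto simp: complex_eq_iff)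
  have cont: "continuous_on UNIV (\<lambda>t. - (complex_of_real (poly q t) / (z - of_real t)\<^sup>2))"
    using nz[OF z] by (intro continuous_intros) auto
  have est: "norm ((cauchy_int \<rho> q w - cauchy_int \<rho> q z) / (w - z) - ?D) \<le> ?N * norm (w - z)"
    if w: "w \<noteq> z" "dist w z < ?\<eta> / 2" for w
  proof -
    have "\<bar>Im (w - z)\<bar> \<le> norm (w - z)" by (rule abs_Im_le_cmod)
    then have Im_w: "?\<eta> / 2 \<le> \<bar>Im w\<bar>" using w by (auto simp: dist_norm)
    then have w0: "Im w \<noteq> 0" using z by auto
    have contw: "continuous_on UNIV (\<lambda>t. (w - z) * of_real (poly q t) / ((w - of_real t) * (z - of_real t)\<^sup>2))"
      using nz[OF z] nz[OF w0] by (intro continuous_intros) auto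
    have "(cauchy_int \<rho> q w - cauchy_int \<rho> q z) / (w - z) - ?D
      = (LINT t|\<rho>. (of_real (poly q t) / (w - of_real t) - of_real (poly q t) / (z - of_real t)) / (w - z)
        - (- (of_real (poly q t) / (z - of_real t)\<^sup>2)))"
      unfolding cauchy_int_def
      using integrable_\<rho>[OF continuous_Cauchy_kernel[OF w0, of q]]
        integrable_\<rho>[OF continuous_Cauchy_kernel[OF z, of q]] integrable_\<rho>[OF cont] by simp
    also have "\<dots> = (LINT t|\<rho>. (w - z) * of_real (poly q t) / ((w - of_real t) * (z - of_real t)\<^sup>2))"
    proof (rule Bochner_Integration.integral_cong[OF refl])
      fix t
      show "(of_real (poly q t) / (w - of_real t) - of_real (poly q t) / (z - of_real t)) / (w - z)
        - (- (of_real (poly q t) / (z - of_real t)\<^sup>2))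
        = (w - z) * of_real (poly q t) / ((w - of_real t) * (z - of_real t)\<^sup>2)"
        using nz[OF z, of t] nz[OF w0, of t] w(1) by (simp add: divide_simps power2_eq_square) (simp add: algebra_simps)
    qed
    also have "norm \<dots> \<le> (LINT t|\<rho>. norm ((w - z) * of_real (poly q t) / ((w - of_real t) * (z - of_real t)\<^sup>2)))"
      by (rule integral_norm_bound)
    also have "\<dots> \<le> (LINT t|\<rho>. \<bar>poly q t\<bar> * (2 / ?\<eta> ^ 3) * norm (w - z))"
    proof (rule integral_mono)
      show "integrable \<rho> (\<lambda>t. norm ((w - z) * of_real (poly q t) / ((w - of_real t) * (z - of_real t)\<^sup>2)))"
        by (intro integrable_norm integrable_\<rho> contw)
      show "integrable \<rho> (\<lambda>t. \<bar>poly q t\<bar> * (2 / ?\<eta> ^ 3) * norm (w - z))"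
        by (intro integrable_\<rho> continuous_intros)
      fix t
      have "?\<eta> \<le> norm (z - of_real t)" using abs_Im_le_cmod[of "z - of_real t"] by simp
      then have "?\<eta>\<^sup>2 \<le> (norm (z - of_real t))\<^sup>2" by (intro power_mono) auto
      moreover have "?\<eta> / 2 \<le> norm (w - of_real t)"
        using abs_Im_le_cmod[of "w - of_real t"] Im_w by simp
      ultimately have "?\<eta> / 2 * ?\<eta>\<^sup>2 \<le> norm (w - of_real t) * (norm (z - of_real t))\<^sup>2"
        by (intro mult_mono) auto
      then have "norm (w - z) * \<bar>poly q t\<bar> / (norm (w - of_real t) * (norm (z - of_real t))\<^sup>2)
        \<le> norm (w - z) * \<bar>poly q t\<bar> / (?\<eta> / 2 * ?\<eta>\<^sup>2)"
        using z by (intro frac_le) auto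
      also have "\<dots> = \<bar>poly q t\<bar> * (2 / ?\<eta> ^ 3) * norm (w - z)"
        using z by (simp add: field_simps power2_eq_square power3_eq_cube)
      finally show "norm ((w - z) * of_real (poly q t) / ((w - of_real t) * (z - of_real t)\<^sup>2))
        \<le> \<bar>poly q t\<bar> * (2 / ?\<eta> ^ 3) * norm (w - z)"
        by (simp add: norm_mult norm_divide norm_power)
    qed
    finally show ?thesis by simp
  qed
  have "((\<lambda>w. (cauchy_int \<rho> q w - cauchy_int \<rho> q z) / (w - z) - ?D) \<longlongrightarrow> 0) (at z)"
  proof (rule Lim_null_comparison)
    have "\<forall>\<^sub>F w in at z. dist w z < ?\<eta> / 2 \<and> w \<noteq> z"
      using z by (auto simp: eventually_at intro!: exI[of _ "?\<eta> / 2"])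
    then show "\<forall>\<^sub>F w in at z.
        norm ((cauchy_int \<rho> q w - cauchy_int \<rho> q z) / (w - z) - ?D) \<le> ?N * norm (w - z)"
      by eventually_elim (rule est, auto)
    have "((\<lambda>w. ?N * norm (w - z)) \<longlongrightarrow> ?N * norm (z - z)) (at z)" by (intro tendsto_intros)
    then show "((\<lambda>w. ?N * norm (w - z)) \<longlongrightarrow> 0) (at z)" by simp
  qed
  then have "((\<lambda>w. (cauchy_int \<rho> q w - cauchy_int \<rho> q z) / (w - z)) \<longlongrightarrow> ?D) (at z)"
    by (subst Lim_null)
  then have "(cauchy_int \<rho> q has_field_derivative ?D) (at z)"
    by (simp add: has_field_derivative_iff)
  then show ?thesis by (auto simp: field_differentiable_def)
qed

end

section \<open>The differential system on the real line\<close>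

lemma Y_mat_nth:
  "Y_mat \<rho> p n z $ 1 $ 1 = poly (map_poly of_real (p n)) z"
  "Y_mat \<rho> p n z $ 1 $ 2 = cauchy_int \<rho> (p n) z"
  "Y_mat \<rho> p n z $ 2 $ 1 = poly (map_poly of_real (p (n-1))) z / of_real (sqnorm \<rho> p (n-1))"
  "Y_mat \<rho> p n z $ 2 $ 2 = 1 / of_real (sqnorm \<rho> p (n-1)) * cauchy_int \<rho> (p (n-1)) z"
  by (simp_all add: Y_mat_def)

lemma w_logderiv_eq:
  assumes c: "2 * real N * lead_coeff v \<noteq> 0" and z: "\<And>j. j \<in> {1..4*N-2} \<Longrightarrow> z \<noteq> of_real (\<delta> j)"
  shows "w_logderiv N v \<delta> z = 1 / 2 * (\<Sum>j=1..4*N-2. 1 / (z - of_real (\<delta> j)))"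
proof -
  let ?P = "\<lambda>z. \<Prod>j=1..4*N-2. (z - complex_of_real (\<delta> j))"
  let ?c = "- (complex_of_real (2 * real N * lead_coeff v))\<^sup>2"
  let ?S = "\<Sum>j=1..4*N-2. 1 / (z - of_real (\<delta> j))"
  have "(?P has_field_derivative ?P z * ?S) (at z)"
    by (rule has_field_derivative_prod') (use z in \<open>auto intro!: derivative_eq_intros\<close>)
  then have "((\<lambda>z. ?c * ?P z) has_field_derivative ?c * (?P z * ?S)) (at z)"
    by (rule DERIV_cmult)
  then have "deriv (w_sq N v \<delta>) z = ?c * (?P z * ?S)"
    unfolding w_sq_def[abs_def] by (rule DERIV_imp_deriv)
  moreover have "?P z \<noteq> 0" using z by (auto simp: prod_zero_iff)
  moreover have "?c \<noteq> 0" using c by (simp only: neg_equal_0_iff_equal power_eq_0_iff of_real_eq_0_iff) simp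
  ultimately show ?thesis unfolding w_logderiv_def w_sq_def by (simp del: of_real_mult)
qed

text \<open>
  The Cauchy transforms jump across the support, but the identities derived from them only involve
  functions that are continuous at real points, and so pass to the limit.
\<close>

lemma isCont_eq_off_real:
  fixes F G :: "complex \<Rightarrow> complex"
  assumes F: "isCont F (of_real x)" and G: "isCont G (of_real x)"
    and eq: "\<And>z. Im z \<noteq> 0 \<Longrightarrow> F z = G z"
  shows "F (of_real x) = G (of_real x)"
proof -
  let ?z = "\<lambda>m. of_real x + \<i> * complex_of_real (inverse (real (Suc m)))"
  have "?z \<longlonglongrightarrow> of_real x + \<i> * complex_of_real 0"
    by (intro tendsto_intros LIMSEQ_inverse_real_of_nat)
  then have "?z \<longlonglongrightarrow> of_real x" by simp
  then have "(\<lambda>m. F (?z m)) \<longlonglongrightarrow> F (of_real x)" "(\<lambda>m. G (?z m)) \<longlonglongrightarrow> G (of_real x)"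
    using isCont_tendsto_compose[OF F] isCont_tendsto_compose[OF G] by blast+
  moreover have "F (?z m) = G (?z m)" for m by (rule eq) simp
  ultimately show ?thesis by (simp add: LIMSEQ_unique)
qed

lemma deriv_poly_map_of_real:
  "deriv (poly (map_poly complex_of_real q)) z = poly (map_poly of_real (pderiv q)) z"
proof -
  have "pderiv (map_poly complex_of_real q) = map_poly of_real (pderiv q)"
    by (rule poly_eqI) (simp add: coeff_pderiv coeff_map_poly)
  then show ?thesis using DERIV_imp_deriv[OF poly_DERIV] by metis
qed

context
  fixes \<rho> :: "real measure" and p :: "nat \<Rightarrow> real poly" and R :: real and N n :: nat
    and v :: "real poly" and \<delta> :: "nat \<Rightarrow> real" and \<alpha> :: "nat \<Rightarrow> real^2^2"
  assumes \<rho>: "prob_space \<rho>" "sets \<rho> = sets borel" "AE x in \<rho>. \<bar>x\<bar> \<le> R"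
    and orth: "monic_orthogonal \<rho> p"
    and n: "1 \<le> n" and h: "sqnorm \<rho> p (n-1) \<noteq> 0"
    and c: "2 * real N * lead_coeff v \<noteq> 0"
    and alpha: "residue_matrices N v \<rho> \<delta> p n \<alpha>"
begin

text \<open>The Wronskian identity says \<open>det Y\<^sub>n = 1\<close> off the real line.\<close>

lemma det_Y_mat:
  assumes z: "Im z \<noteq> 0"
  shows "Y_mat \<rho> p n z $ 1 $ 1 * Y_mat \<rho> p n z $ 2 $ 2
    - Y_mat \<rho> p n z $ 1 $ 2 * Y_mat \<rho> p n z $ 2 $ 1 = 1"
  using Cauchy_transform_Wronskian[OF \<rho> orth n z] h
  by (simp add: Y_mat_nth field_simps)

lemma Y_mat_differentiable:
  assumes z: "Im z \<noteq> 0"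
  shows "(\<lambda>s. Y_mat \<rho> p n s $ i $ l) field_differentiable at z"
proof -
  note C = cauchy_int_differentiable[OF \<rho> orth z]
  have P: "(\<lambda>s. poly (map_poly complex_of_real q) s) field_differentiable at z" for q
    using poly_DERIV[of "map_poly complex_of_real q" z] field_differentiable_def by blast
  have "i = 1 \<or> i = 2" "l = 1 \<or> l = 2" using exhaust_2 by auto
  moreover have "(\<lambda>s. Y_mat \<rho> p n s $ 1 $ 1) field_differentiable at z"
    unfolding Y_mat_nth by (rule P)
  moreover have "(\<lambda>s. Y_mat \<rho> p n s $ 1 $ 2) field_differentiable at z"
    unfolding Y_mat_nth by (rule C)
  moreover have "(\<lambda>s. Y_mat \<rho> p n s $ 2 $ 1) field_differentiable at z"
    unfolding Y_mat_nth using h by (intro field_differentiable_divide P field_differentiable_const) auto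
  moreover have "(\<lambda>s. Y_mat \<rho> p n s $ 2 $ 2) field_differentiable at z"
    unfolding Y_mat_nth by (intro field_differentiable_mult C field_differentiable_const)
  ultimately show ?thesis by auto
qed

lemma A_mat_mult_Y_mat:
  assumes z: "Im z \<noteq> 0"
  shows "A_mat N v \<rho> \<delta> p n z ** Y_mat \<rho> p n z
    = mat_deriv (Y_mat \<rho> p n) z + Y_mat \<rho> p n z ** mat22 0 0 0 (- w_logderiv N v \<delta> z)"
proof -
  have "det (Y_mat \<rho> p n z) \<noteq> 0" using det_Y_mat[OF z] by (simp add: det_2 mult.commute)
  then have "matrix_inv (Y_mat \<rho> p n z) ** Y_mat \<rho> p n z = mat 1" by (rule matrix_inv_left_det)
  moreover have "(A + B) ** C = A ** C + B ** C" for A B C :: "complex^2^2"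
    by (simp add: vec_eq_iff matrix_mult_22 algebra_simps)
  ultimately show ?thesis
    unfolding A_mat_def by (simp add: matrix_mul_assoc[symmetric])
qed

text \<open>As \<open>det Y\<^sub>n\<close> is constant, only the diagonal term contributes to the trace.\<close>

lemma trace_A_mat:
  assumes z: "Im z \<noteq> 0"
  shows "A_mat N v \<rho> \<delta> p n z $ 1 $ 1 + A_mat N v \<rho> \<delta> p n z $ 2 $ 2 = - w_logderiv N v \<delta> z"
proof -
  let ?Y = "\<lambda>i l s. Y_mat \<rho> p n s $ i $ l" and ?A = "A_mat N v \<rho> \<delta> p n z"
  let ?w = "w_logderiv N v \<delta> z"
  have D: "(?Y i l has_field_derivative deriv (?Y i l) z) (at z)" for i l
    by (rule field_differentiable_derivI[OF Y_mat_differentiable[OF z]])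
  have "((\<lambda>s. ?Y 1 1 s * ?Y 2 2 s - ?Y 1 2 s * ?Y 2 1 s) has_field_derivative
      (deriv (?Y 1 1) z * ?Y 2 2 z + deriv (?Y 2 2) z * ?Y 1 1 z)
      - (deriv (?Y 1 2) z * ?Y 2 1 z + deriv (?Y 2 1) z * ?Y 1 2 z)) (at z)"
    by (rule DERIV_diff[OF DERIV_mult[OF D[of 1 1] D[of 2 2]] DERIV_mult[OF D[of 1 2] D[of 2 1]]])
  moreover have "((\<lambda>s. ?Y 1 1 s * ?Y 2 2 s - ?Y 1 2 s * ?Y 2 1 s) has_field_derivative 0) (at z)"
  proof (rule has_field_derivative_transform_within_open[where f = "\<lambda>s. 1"])
    have "open (Im -` (- {0}))" by (intro open_vimage continuous_intros)
    then show "open {s. Im s \<noteq> 0}" by (simp add: vimage_def)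
  qed (use z det_Y_mat in auto)
  ultimately have det': "(deriv (?Y 1 1) z * ?Y 2 2 z + deriv (?Y 2 2) z * ?Y 1 1 z)
      - (deriv (?Y 1 2) z * ?Y 2 1 z + deriv (?Y 2 1) z * ?Y 1 2 z) = 0"
    by (rule DERIV_unique)
  have ent: "?A $ i $ 1 * ?Y 1 l z + ?A $ i $ 2 * ?Y 2 l z
      = deriv (?Y i l) z + (if l = 2 then - ?Y i 2 z * ?w else 0)" for i l
  proof -
    have "(?A ** Y_mat \<rho> p n z) $ i $ l
      = (mat_deriv (Y_mat \<rho> p n) z + Y_mat \<rho> p n z ** mat22 0 0 0 (- ?w)) $ i $ l"
      by (simp only: A_mat_mult_Y_mat[OF z])
    moreover have "l = 1 \<or> l = 2" using exhaust_2 by auto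
    ultimately show ?thesis by (auto simp: matrix_mult_22 mat_deriv_def)
  qed
  have e: "?A $ i $ 1 * ?Y 1 1 z + ?A $ i $ 2 * ?Y 2 1 z = deriv (?Y i 1) z"
      "?A $ i $ 1 * ?Y 1 2 z + ?A $ i $ 2 * ?Y 2 2 z = deriv (?Y i 2) z - ?Y i 2 z * ?w" for i
    using ent[of i 1] ent[of i 2] by simp_all
  \<comment> \<open>Solve the entries of \<open>A Y = Y' + Y D\<close> for the diagonal of \<open>A\<close> by Cramer's rule.\<close>
  have "?A $ 1 $ 1 = ?A $ 1 $ 1 * (?Y 1 1 z * ?Y 2 2 z - ?Y 1 2 z * ?Y 2 1 z)"
    by (simp only: det_Y_mat[OF z] mult_1_right)
  also have "\<dots> = ?Y 2 2 z * (?A $ 1 $ 1 * ?Y 1 1 z + ?A $ 1 $ 2 * ?Y 2 1 z)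
      - ?Y 2 1 z * (?A $ 1 $ 1 * ?Y 1 2 z + ?A $ 1 $ 2 * ?Y 2 2 z)" by algebra
  also have "\<dots> = ?Y 2 2 z * deriv (?Y 1 1) z - ?Y 2 1 z * (deriv (?Y 1 2) z - ?Y 1 2 z * ?w)"
    by (simp only: e)
  finally have A1: "?A $ 1 $ 1 = ?Y 2 2 z * deriv (?Y 1 1) z - ?Y 2 1 z * (deriv (?Y 1 2) z - ?Y 1 2 z * ?w)" .
  have "?A $ 2 $ 2 = ?A $ 2 $ 2 * (?Y 1 1 z * ?Y 2 2 z - ?Y 1 2 z * ?Y 2 1 z)"
    by (simp only: det_Y_mat[OF z] mult_1_right)
  also have "\<dots> = ?Y 1 1 z * (?A $ 2 $ 1 * ?Y 1 2 z + ?A $ 2 $ 2 * ?Y 2 2 z)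
      - ?Y 1 2 z * (?A $ 2 $ 1 * ?Y 1 1 z + ?A $ 2 $ 2 * ?Y 2 1 z)" by algebra
  also have "\<dots> = ?Y 1 1 z * (deriv (?Y 2 2) z - ?Y 2 2 z * ?w) - ?Y 1 2 z * deriv (?Y 2 1) z"
    by (simp only: e)
  finally have A2: "?A $ 2 $ 2 = ?Y 1 1 z * (deriv (?Y 2 2) z - ?Y 2 2 z * ?w) - ?Y 1 2 z * deriv (?Y 2 1) z" .
  have "?A $ 1 $ 1 + ?A $ 2 $ 2 = - ?w * (?Y 1 1 z * ?Y 2 2 z - ?Y 1 2 z * ?Y 2 1 z)"
    unfolding A1 A2 using det' by algebra
  then show ?thesis by (simp only: det_Y_mat[OF z] mult_1_right)
qed

lemma A_mat_residues:
  assumes z: "Im z \<noteq> 0"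
  shows "A_mat N v \<rho> \<delta> p n z $ i $ l = (\<Sum>j=1..4*N-2. of_real (\<alpha> j $ i $ l) / (z - of_real (\<delta> j)))"
proof -
  have "z \<notin> complex_of_real ` (msupport \<rho> \<union> \<delta> ` {1..4*N-2})" using z by auto
  then have "A_mat N v \<rho> \<delta> p n z
      = (\<chi> i l. \<Sum>j=1..4*N-2. of_real (\<alpha> j $ i $ l) / (z - of_real (\<delta> j)))"
    using alpha unfolding residue_matrices_def by blast
  then show ?thesis by simp
qed

lemma residue_trace_sum:
  assumes x: "\<And>j. j \<in> {1..4*N-2} \<Longrightarrow> x \<noteq> \<delta> j"
  shows "(\<Sum>j=1..4*N-2. trace (\<alpha> j) / (x - \<delta> j)) = - (1/2) * (\<Sum>j=1..4*N-2. 1 / (x - \<delta> j))"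
proof -
  let ?F = "\<lambda>z. \<Sum>j=1..4*N-2. complex_of_real (trace (\<alpha> j)) / (z - of_real (\<delta> j))"
  let ?G = "\<lambda>z. - (1/2) * (\<Sum>j=1..4*N-2. 1 / (z - complex_of_real (\<delta> j)))"
  have "?F (of_real x) = ?G (of_real x)"
  proof (rule isCont_eq_off_real[where F = ?F and G = ?G])
    show "isCont ?F (of_real x)" "isCont ?G (of_real x)"
      using x by (auto intro!: continuous_intros)
    fix z :: complex assume z: "Im z \<noteq> 0"
    have "?F z = (\<Sum>j=1..4*N-2. of_real (\<alpha> j $ 1 $ 1) / (z - of_real (\<delta> j)))
        + (\<Sum>j=1..4*N-2. of_real (\<alpha> j $ 2 $ 2) / (z - of_real (\<delta> j)))"
      by (simp add: trace_def sum_2 add_divide_distrib sum.distrib)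
    also have "\<dots> = - w_logderiv N v \<delta> z"
      using trace_A_mat[OF z] by (simp only: A_mat_residues[OF z])
    also have "\<dots> = ?G z"
      using z by (subst w_logderiv_eq[OF c]) auto
    finally show "?F z = ?G z" .
  qed
  then have "complex_of_real (\<Sum>j=1..4*N-2. trace (\<alpha> j) / (x - \<delta> j))
      = complex_of_real (- (1/2) * (\<Sum>j=1..4*N-2. 1 / (x - \<delta> j)))" by simp
  then show ?thesis by (simp only: of_real_eq_iff)
qed

text \<open>The first column of \<open>Y\<^sub>n\<close> solves \<open>Y' = A Y\<close>, and it is a polynomial, hence real on the line.\<close>

lemma first_column_equation:
  assumes x: "\<And>j. j \<in> {1..4*N-2} \<Longrightarrow> x \<noteq> \<delta> j"
  defines "q \<equiv> \<lambda>i::2. if i = 1 then p n else smult (1 / sqnorm \<rho> p (n-1)) (p (n-1))"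
  shows "(\<Sum>j=1..4*N-2. (\<alpha> j $ i $ 1 * poly (q 1) x + \<alpha> j $ i $ 2 * poly (q 2) x) / (x - \<delta> j))
    = poly (pderiv (q i)) x"
proof -
  let ?q = "\<lambda>i. poly (map_poly complex_of_real (q i))"
  have Y: "Y_mat \<rho> p n s $ i $ 1 = ?q i s" for i s
  proof -
    have "i = 1 \<or> i = 2" using exhaust_2 by auto
    then show ?thesis by (auto simp: Y_mat_nth q_def map_poly_smult)
  qed
  let ?F = "\<lambda>z. \<Sum>j=1..4*N-2. (of_real (\<alpha> j $ i $ 1) * ?q 1 z + of_real (\<alpha> j $ i $ 2) * ?q 2 z) / (z - of_real (\<delta> j))"
  let ?G = "\<lambda>z. poly (map_poly complex_of_real (pderiv (q i))) z"
  have "?F (of_real x) = ?G (of_real x)"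
  proof (rule isCont_eq_off_real[where F = ?F and G = ?G])
    show "isCont ?F (of_real x)" "isCont ?G (of_real x)"
      using x by (auto intro!: continuous_intros)
    fix z :: complex assume z: "Im z \<noteq> 0"
    \<comment> \<open>The diagonal matrix in \<open>A\<close> has first column zero, so this column sees no \<open>w'\<close>.\<close>
    have "?F z = (\<Sum>j=1..4*N-2. of_real (\<alpha> j $ i $ 1) / (z - of_real (\<delta> j))) * ?q 1 z
        + (\<Sum>j=1..4*N-2. of_real (\<alpha> j $ i $ 2) / (z - of_real (\<delta> j))) * ?q 2 z"
      by (simp add: add_divide_distrib sum.distrib sum_distrib_right)
    also have "\<dots> = (A_mat N v \<rho> \<delta> p n z ** Y_mat \<rho> p n z) $ i $ 1"
      by (simp only: A_mat_residues[OF z] matrix_mult_22 Y)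
    also have "\<dots> = deriv (?q i) z"
      by (simp add: A_mat_mult_Y_mat[OF z] matrix_mult_22 mat_deriv_def Y)
    finally show "?F z = ?G z" by (simp only: deriv_poly_map_of_real)
  qed
  then have "complex_of_real (\<Sum>j=1..4*N-2.
        (\<alpha> j $ i $ 1 * poly (q 1) x + \<alpha> j $ i $ 2 * poly (q 2) x) / (x - \<delta> j))
      = complex_of_real (poly (pderiv (q i)) x)" by (simp add: poly_map_of_real)
  then show ?thesis by (simp only: of_real_eq_iff)
qed

end

section \<open>Kernels dominated by a rank one kernel\<close>

text \<open>
  Everything about the operators is derived from the pointwise bound \<open>\<bar>k(x, y)\<bar> \<le> C \<bar>e(x)\<bar> \<bar>e(y)\<bar>\<close>
  with \<open>e\<close> square integrable. It makes all integrals absolutely convergent at every point, without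
  exceptional null sets, and justifies the exchange of integrals.
\<close>

lemma norm_integral_le:
  fixes f :: "'a \<Rightarrow> 'b::euclidean_space"
  assumes "integrable M f" "integrable M g" "\<And>x. x \<in> space M \<Longrightarrow> norm (f x) \<le> g x"
  shows "norm (LINT x|M. f x) \<le> (LINT x|M. g x)"
proof -
  have "(LINT x|M. norm (f x)) \<le> (LINT x|M. g x)"
    by (rule integral_mono) (use assms in auto)
  then show ?thesis using integral_norm_bound[of M f] by linarith
qed

lemma L2_integrable_norm_mult:
  fixes f :: "'a \<Rightarrow> 'b::euclidean_space" and g :: "'a \<Rightarrow> 'c::euclidean_space"
  assumes f: "f \<in> L2_space M" and g: "g \<in> L2_space M"
  shows "integrable M (\<lambda>x. norm (f x) * norm (g x))"
proof -
  have [measurable]: "f \<in> borel_measurable M" "g \<in> borel_measurable M"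
    using f g by (auto simp: L2_space_def)
  have int: "integrable M (\<lambda>x. (norm (f x))\<^sup>2 + (norm (g x))\<^sup>2)"
    using f g by (auto simp: L2_space_def)
  show ?thesis
  proof (rule Bochner_Integration.integrable_bound[OF int])
    show "AE x in M. norm (norm (f x) * norm (g x)) \<le> norm ((norm (f x))\<^sup>2 + (norm (g x))\<^sup>2)"
    proof (rule AE_I2)
      fix x
      have "2 * (norm (f x) * norm (g x)) \<le> (norm (f x))\<^sup>2 + (norm (g x))\<^sup>2"
        using sum_squares_bound[of "norm (f x)" "norm (g x)"] by simp
      moreover have "0 \<le> norm (f x) * norm (g x)" by simp
      ultimately show "norm (norm (f x) * norm (g x)) \<le> norm ((norm (f x))\<^sup>2 + (norm (g x))\<^sup>2)"
        unfolding real_norm_def by linarith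
    qed
  qed simp
qed

lemma L2_integrable_inner:
  fixes f g :: "'a \<Rightarrow> 'b::euclidean_space"
  assumes f: "f \<in> L2_space M" and g: "g \<in> L2_space M"
  shows "integrable M (\<lambda>x. f x \<bullet> g x)"
proof (rule Bochner_Integration.integrable_bound[OF L2_integrable_norm_mult[OF f g]])
  have [measurable]: "f \<in> borel_measurable M" "g \<in> borel_measurable M"
    using f g by (auto simp: L2_space_def)
  show "(\<lambda>x. f x \<bullet> g x) \<in> borel_measurable M" by measurable
qed (simp add: Cauchy_Schwarz_ineq2)

lemma L2_nrm_nonneg: "0 \<le> L2_nrm M f"
  by (simp add: L2_nrm_def L2_inner_def)

lemma L2_nrm_square: "(L2_nrm M f)\<^sup>2 = (LINT x|M. (norm (f x))\<^sup>2)"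
  by (simp add: L2_nrm_def L2_inner_def power2_norm_eq_inner)

text \<open>
  The Cauchy-Schwarz inequality, from the sign of the quadratic polynomial
  \<open>s \<mapsto> \<integral> (\<bar>f\<bar> - s \<bar>g\<bar>)\<^sup>2\<close>.
\<close>

lemma L2_Cauchy_Schwarz:
  fixes f :: "'a \<Rightarrow> 'b::euclidean_space" and g :: "'a \<Rightarrow> 'c::euclidean_space"
  assumes f: "f \<in> L2_space M" and g: "g \<in> L2_space M"
  shows "(LINT x|M. norm (f x) * norm (g x)) \<le> L2_nrm M f * L2_nrm M g"
proof -
  let ?F = "LINT x|M. (norm (f x))\<^sup>2" and ?G = "LINT x|M. (norm (g x))\<^sup>2"
  let ?I = "LINT x|M. norm (f x) * norm (g x)"
  have int: "integrable M (\<lambda>x. (norm (f x))\<^sup>2)" "integrable M (\<lambda>x. (norm (g x))\<^sup>2)"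
    "integrable M (\<lambda>x. norm (f x) * norm (g x))"
    using f g L2_integrable_norm_mult[OF f g] by (auto simp: L2_space_def)
  have quad: "0 \<le> ?F - 2 * s * ?I + s\<^sup>2 * ?G" for s
  proof -
    have "0 \<le> (LINT x|M. (norm (f x) - s * norm (g x))\<^sup>2)" by simp
    also have "(\<lambda>x. (norm (f x) - s * norm (g x))\<^sup>2)
      = (\<lambda>x. ((norm (f x))\<^sup>2 - (2 * s) * (norm (f x) * norm (g x))) + s\<^sup>2 * (norm (g x))\<^sup>2)"
      by (simp add: power2_diff power_mult_distrib fun_eq_iff)
    also have "(LINT x|M. ((norm (f x))\<^sup>2 - (2 * s) * (norm (f x) * norm (g x))) + s\<^sup>2 * (norm (g x))\<^sup>2)
      = ?F - 2 * s * ?I + s\<^sup>2 * ?G"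
      using int by simp
    finally show ?thesis .
  qed
  have "?I\<^sup>2 \<le> ?F * ?G"
  proof (cases "?G = 0")
    case True
    have "?I = 0"
    proof (rule ccontr)
      assume "?I \<noteq> 0"
      then show False using quad[of "(?F + 1) / (2 * ?I)"] True by (simp add: field_simps)
    qed
    then show ?thesis using True by simp
  next
    case False
    moreover have "0 \<le> ?G" by simp
    ultimately have pos: "0 < ?G" by linarith
    have "0 \<le> (?F - 2 * (?I / ?G) * ?I + (?I / ?G)\<^sup>2 * ?G) * ?G"
      using quad[of "?I / ?G"] pos by simp
    also have "\<dots> = ?F * ?G - ?I\<^sup>2"
      using pos by (simp add: field_simps power2_eq_square)
    finally show ?thesis by simp
  qed
  then have "?I\<^sup>2 \<le> (L2_nrm M f * L2_nrm M g)\<^sup>2"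
    by (simp add: L2_nrm_square power_mult_distrib)
  then show ?thesis
    by (rule power2_le_imp_le) (simp add: L2_nrm_nonneg)
qed

lemma L2_space_dominated:
  fixes f :: "'a \<Rightarrow> 'b::euclidean_space" and e :: "'a \<Rightarrow> 'c::euclidean_space"
  assumes e: "e \<in> L2_space M" and [measurable]: "f \<in> borel_measurable M"
    and le: "\<And>x. x \<in> space M \<Longrightarrow> norm (f x) \<le> c * norm (e x)"
  shows "f \<in> L2_space M"
proof -
  have int: "integrable M (\<lambda>x. c\<^sup>2 * (norm (e x))\<^sup>2)" using e by (simp add: L2_space_def)
  have "(norm (f x))\<^sup>2 \<le> c\<^sup>2 * (norm (e x))\<^sup>2" if "x \<in> space M" for x
    unfolding power_mult_distrib[symmetric] by (rule power_mono[OF le[OF that]]) simp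
  then have "integrable M (\<lambda>x. (norm (f x))\<^sup>2)"
    by (intro Bochner_Integration.integrable_bound[OF int]) auto
  then show ?thesis by (simp add: L2_space_def)
qed

lemma L2_space_bounded_linear:
  fixes f :: "'a \<Rightarrow> 'b::euclidean_space" and T :: "'b \<Rightarrow> 'c::euclidean_space"
  assumes T: "bounded_linear T" and f: "f \<in> L2_space M"
  shows "(\<lambda>x. T (f x)) \<in> L2_space M"
proof -
  obtain B where B: "\<And>v. norm (T v) \<le> norm v * B" using bounded_linear.bounded[OF T] by blast
  have "T \<in> borel_measurable borel"
    by (intro borel_measurable_continuous_onI linear_continuous_on T)
  moreover have "f \<in> borel_measurable M" using f by (simp add: L2_space_def)
  ultimately have "(\<lambda>x. T (f x)) \<in> borel_measurable M" by measurable
  then show ?thesis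
    by (rule L2_space_dominated[OF f, where c = B]) (use B in \<open>simp add: mult.commute\<close>)
qed

lemma L2_space_sum:
  fixes f :: "'i \<Rightarrow> 'a \<Rightarrow> real"
  assumes "\<And>i. i \<in> I \<Longrightarrow> f i \<in> L2_space M"
  shows "(\<lambda>x. \<Sum>i\<in>I. f i x) \<in> L2_space M"
  using assms
proof (induction I rule: infinite_finite_induct)
  case (insert i I)
  have f: "f i \<in> L2_space M" and g: "(\<lambda>x. \<Sum>i\<in>I. f i x) \<in> L2_space M" using insert by auto
  have [measurable]: "f i \<in> borel_measurable M" "(\<lambda>x. \<Sum>i\<in>I. f i x) \<in> borel_measurable M"
    using f g by (auto simp: L2_space_def)
  have "integrable M (\<lambda>x. (f i x)\<^sup>2 + (\<Sum>i\<in>I. f i x)\<^sup>2 + 2 * (f i x * (\<Sum>i\<in>I. f i x)))"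
    using f g L2_integrable_inner[OF f g] by (simp add: L2_space_def)
  then have "integrable M (\<lambda>x. (f i x + (\<Sum>i\<in>I. f i x))\<^sup>2)"
    by (simp add: power2_sum mult.assoc)
  then show ?case using insert(1,2) by (simp add: L2_space_def)
qed (simp_all add: L2_space_def)

lemma integrable_product_of_integrable:
  fixes f :: "'a \<Rightarrow> real" and g :: "'b \<Rightarrow> real"
  assumes M: "sigma_finite_measure M" and N: "sigma_finite_measure N"
    and f: "integrable M f" and g: "integrable N g"
  shows "integrable (M \<Otimes>\<^sub>M N) (\<lambda>z. f (fst z) * g (snd z))"
proof -
  interpret M: sigma_finite_measure M by fact
  interpret N: sigma_finite_measure N by fact
  interpret pair_sigma_finite M N ..
  have [measurable]: "f \<in> borel_measurable M" "g \<in> borel_measurable N"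
    using f g by auto
  show ?thesis
  proof (rule Fubini_integrable)
    have "integrable M (\<lambda>x. \<bar>f x\<bar> * (LINT y|N. \<bar>g y\<bar>))"
      using f by simp
    then show "integrable M (\<lambda>x. LINT y|N. norm (f (fst (x, y)) * g (snd (x, y))))"
      by (simp add: abs_mult)
  qed (use g in simp_all)
qed

definition dominated_kernel ::
  "'a measure \<Rightarrow> ('a \<Rightarrow> real) \<Rightarrow> real \<Rightarrow> ('a \<Rightarrow> 'a \<Rightarrow> 'b::euclidean_space) \<Rightarrow> bool" where
  "dominated_kernel M e C k \<longleftrightarrow>
     (\<lambda>z. k (fst z) (snd z)) \<in> borel_measurable (M \<Otimes>\<^sub>M M) \<and>
     (\<forall>x\<in>space M. \<forall>y\<in>space M. norm (k x y) \<le> C * norm (e x) * norm (e y))"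

context
  fixes M :: "'a measure" and e :: "'a \<Rightarrow> real" and C :: real
    and k :: "'a \<Rightarrow> 'a \<Rightarrow> 'b::euclidean_space"
  assumes sf: "sigma_finite_measure M" and e: "e \<in> L2_space M" and C: "0 \<le> C"
    and k: "dominated_kernel M e C k"
begin

interpretation sigma_finite_measure M by (rule sf)
interpretation pair_sigma_finite M M ..

lemma dominated_kernel_measurable:
  "(\<lambda>z. k (fst z) (snd z)) \<in> borel_measurable (M \<Otimes>\<^sub>M M)"
  using k by (simp add: dominated_kernel_def)

lemma dominated_kernel_bound:
  "x \<in> space M \<Longrightarrow> y \<in> space M \<Longrightarrow> norm (k x y) \<le> C * norm (e x) * norm (e y)"
  using k by (simp add: dominated_kernel_def)

lemma dominated_kernel_integrable:
  assumes f: "f \<in> L2_space M" and x: "x \<in> space M"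
  shows "integrable M (\<lambda>y. f y *\<^sub>R k x y)"
proof -
  have [measurable]: "f \<in> borel_measurable M" using f by (simp add: L2_space_def)
  have [measurable]: "(\<lambda>y. k x y) \<in> borel_measurable M"
    using measurable_compose[OF measurable_Pair1'[OF x] dominated_kernel_measurable] by simp
  have "integrable M (\<lambda>y. C * norm (e x) * (norm (e y) * norm (f y)))"
    using L2_integrable_norm_mult[OF e f] by simp
  then show ?thesis
  proof (rule Bochner_Integration.integrable_bound)
    show "AE y in M. norm (f y *\<^sub>R k x y) \<le> norm (C * norm (e x) * (norm (e y) * norm (f y)))"
    proof (rule AE_I2)
      fix y assume "y \<in> space M"
      then have "norm (f y) * norm (k x y) \<le> norm (f y) * (C * norm (e x) * norm (e y))"
        by (intro mult_left_mono dominated_kernel_bound x) auto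
      then show "norm (f y *\<^sub>R k x y) \<le> norm (C * norm (e x) * (norm (e y) * norm (f y)))"
        using C by (simp add: abs_mult mult_ac)
    qed
  qed simp
qed

lemma dominated_kernel_pointwise:
  assumes f: "f \<in> L2_space M" and x: "x \<in> space M"
  shows "norm (LINT y|M. f y *\<^sub>R k x y) \<le> C * L2_nrm M e * L2_nrm M f * norm (e x)"
proof -
  have "norm (LINT y|M. f y *\<^sub>R k x y) \<le> (LINT y|M. C * norm (e x) * (norm (e y) * norm (f y)))"
  proof (rule norm_integral_le)
    show "integrable M (\<lambda>y. C * norm (e x) * (norm (e y) * norm (f y)))"
      using L2_integrable_norm_mult[OF e f] by simp
    fix y assume "y \<in> space M"
    then have "norm (f y) * norm (k x y) \<le> norm (f y) * (C * norm (e x) * norm (e y))"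
      by (intro mult_left_mono dominated_kernel_bound x) auto
    then show "norm (f y *\<^sub>R k x y) \<le> C * norm (e x) * (norm (e y) * norm (f y))"
      by (simp add: mult_ac)
  qed (rule dominated_kernel_integrable[OF f x])
  also have "\<dots> = C * norm (e x) * (LINT y|M. norm (e y) * norm (f y))" by simp
  also have "\<dots> \<le> C * norm (e x) * (L2_nrm M e * L2_nrm M f)"
    using C by (intro mult_left_mono L2_Cauchy_Schwarz e f) auto
  finally show ?thesis by (simp add: mult_ac)
qed

lemma dominated_kernel_apply_measurable:
  assumes f: "f \<in> L2_space M"
  shows "(\<lambda>x. LINT y|M. f y *\<^sub>R k x y) \<in> borel_measurable M"
proof -
  have [measurable]: "f \<in> borel_measurable M" using f by (simp add: L2_space_def)
  have "(\<lambda>(x, y). f y *\<^sub>R k x y) \<in> borel_measurable (M \<Otimes>\<^sub>M M)"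
    using dominated_kernel_measurable by (simp add: split_beta)
  then show ?thesis by measurable
qed

lemma dominated_kernel_apply_L2:
  assumes f: "f \<in> L2_space M"
  shows "(\<lambda>x. LINT y|M. f y *\<^sub>R k x y) \<in> L2_space M"
    and "L2_nrm M (\<lambda>x. LINT y|M. f y *\<^sub>R k x y) \<le> C * (L2_nrm M e)\<^sup>2 * L2_nrm M f"
proof -
  let ?h = "\<lambda>x. LINT y|M. f y *\<^sub>R k x y" and ?c = "C * L2_nrm M e * L2_nrm M f"
  have [measurable]: "?h \<in> borel_measurable M" by (rule dominated_kernel_apply_measurable[OF f])
  have le: "(norm (?h x))\<^sup>2 \<le> ?c\<^sup>2 * (norm (e x))\<^sup>2" if "x \<in> space M" for x
    unfolding power_mult_distrib[symmetric]
    by (rule power_mono[OF dominated_kernel_pointwise[OF f that]]) simp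
  have int_e: "integrable M (\<lambda>x. ?c\<^sup>2 * (norm (e x))\<^sup>2)" using e by (simp add: L2_space_def)
  have int: "integrable M (\<lambda>x. (norm (?h x))\<^sup>2)"
    by (rule Bochner_Integration.integrable_bound[OF int_e]) (use le in auto)
  show "?h \<in> L2_space M"
    by (rule L2_space_dominated[OF e _ dominated_kernel_pointwise[OF f]]) simp_all
  have "(L2_nrm M ?h)\<^sup>2 \<le> (LINT x|M. ?c\<^sup>2 * (norm (e x))\<^sup>2)"
    unfolding L2_nrm_square by (intro integral_mono int int_e le)
  also have "\<dots> = (?c * L2_nrm M e)\<^sup>2" by (simp add: L2_nrm_square power_mult_distrib)
  finally have "L2_nrm M ?h \<le> ?c * L2_nrm M e"
    by (rule power2_le_imp_le) (simp add: C L2_nrm_nonneg)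
  then show "L2_nrm M ?h \<le> C * (L2_nrm M e)\<^sup>2 * L2_nrm M f"
    by (simp add: power2_eq_square mult_ac)
qed

text \<open>
  The transpose is applied to functions with values in the target of the kernel, hence needs its
  own version; its values are again dominated by a multiple of \<^term>\<open>e\<close>.
\<close>

lemma dominated_kernel_transpose_apply_L2:
  assumes F: "F \<in> L2_space M"
  shows "(\<lambda>y. LINT x|M. k x y \<bullet> F x) \<in> L2_space M"
proof -
  let ?h = "\<lambda>y. LINT x|M. k x y \<bullet> F x" and ?c = "C * (LINT x|M. norm (e x) * norm (F x))"
  have Fm [measurable]: "F \<in> borel_measurable M" using F by (simp add: L2_space_def)
  have m: "(\<lambda>z. k (fst z) (snd z) \<bullet> F (fst z)) \<in> borel_measurable (M \<Otimes>\<^sub>M M)"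
    using dominated_kernel_measurable by measurable
  have "(\<lambda>(y, x). k x y \<bullet> F x) \<in> borel_measurable (M \<Otimes>\<^sub>M M)"
    using measurable_compose[OF measurable_pair_swap' m] by (simp add: split_beta)
  then have hm [measurable]: "?h \<in> borel_measurable M" by measurable
  have bound: "norm (?h y) \<le> ?c * norm (e y)" if y: "y \<in> space M" for y
  proof -
    have int: "integrable M (\<lambda>x. C * norm (e y) * (norm (e x) * norm (F x)))"
      using L2_integrable_norm_mult[OF e F] by simp
    have le: "norm (k x y \<bullet> F x) \<le> C * norm (e y) * (norm (e x) * norm (F x))"
      if "x \<in> space M" for x
    proof -
      have "norm (k x y \<bullet> F x) \<le> norm (k x y) * norm (F x)" by (simp add: Cauchy_Schwarz_ineq2)
      also have "\<dots> \<le> (C * norm (e x) * norm (e y)) * norm (F x)"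
        by (intro mult_right_mono dominated_kernel_bound that y) auto
      finally show ?thesis by (simp add: mult_ac)
    qed
    have [measurable]: "(\<lambda>x. k x y \<bullet> F x) \<in> borel_measurable M"
      using measurable_compose[OF measurable_Pair2'[OF y] m] by simp
    have "norm (?h y) \<le> (LINT x|M. C * norm (e y) * (norm (e x) * norm (F x)))"
    proof (rule norm_integral_le)
      show "integrable M (\<lambda>x. k x y \<bullet> F x)"
      proof (rule Bochner_Integration.integrable_bound[OF int])
        show "AE x in M. norm (k x y \<bullet> F x) \<le> norm (C * norm (e y) * (norm (e x) * norm (F x)))"
          by (rule AE_I2, rule order_trans[OF le]) auto
      qed simp
    qed (use int le in auto)
    also have "\<dots> = C * norm (e y) * (LINT x|M. norm (e x) * norm (F x))" by simp
    finally show ?thesis by (simp add: mult_ac)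
  qed
  show ?thesis by (rule L2_space_dominated[OF e hm bound])
qed

lemma dominated_kernel_transpose_integral:
  assumes f: "f \<in> L2_space M" and F: "F \<in> L2_space M"
  shows "(LINT x|M. (LINT y|M. f y *\<^sub>R k x y) \<bullet> F x)
    = (LINT y|M. f y * (LINT x|M. k x y \<bullet> F x))"
proof -
  have [measurable]: "f \<in> borel_measurable M" "F \<in> borel_measurable M"
    using f F by (auto simp: L2_space_def)
  have bound: "integrable (M \<Otimes>\<^sub>M M)
      (\<lambda>z. (norm (e (fst z)) * norm (F (fst z))) * (C * (norm (e (snd z)) * norm (f (snd z)))))"
    by (rule integrable_product_of_integrable[OF sf sf
          L2_integrable_norm_mult[OF e F] integrable_mult_right[OF L2_integrable_norm_mult[OF e f]]])
  have int: "integrable (M \<Otimes>\<^sub>M M) (\<lambda>(x, y). f y * (k x y \<bullet> F x))"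
    unfolding split_beta
  proof (rule Bochner_Integration.integrable_bound[OF bound])
    show "(\<lambda>z. f (snd z) * (k (fst z) (snd z) \<bullet> F (fst z))) \<in> borel_measurable (M \<Otimes>\<^sub>M M)"
      using dominated_kernel_measurable by measurable
    show "AE z in M \<Otimes>\<^sub>M M. norm (f (snd z) * (k (fst z) (snd z) \<bullet> F (fst z)))
      \<le> norm ((norm (e (fst z)) * norm (F (fst z))) * (C * (norm (e (snd z)) * norm (f (snd z)))))"
    proof (rule AE_I2)
      fix z assume "z \<in> space (M \<Otimes>\<^sub>M M)"
      then have z: "fst z \<in> space M" "snd z \<in> space M" by (auto simp: space_pair_measure)
      have "\<bar>k (fst z) (snd z) \<bullet> F (fst z)\<bar> \<le> norm (k (fst z) (snd z)) * norm (F (fst z))"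
        by (rule Cauchy_Schwarz_ineq2)
      also have "\<dots> \<le> (C * norm (e (fst z)) * norm (e (snd z))) * norm (F (fst z))"
        by (intro mult_right_mono dominated_kernel_bound z) auto
      finally have "\<bar>f (snd z)\<bar> * \<bar>k (fst z) (snd z) \<bullet> F (fst z)\<bar>
        \<le> \<bar>f (snd z)\<bar> * ((C * norm (e (fst z)) * norm (e (snd z))) * norm (F (fst z)))"
        by (intro mult_left_mono) auto
      then show "norm (f (snd z) * (k (fst z) (snd z) \<bullet> F (fst z)))
        \<le> norm ((norm (e (fst z)) * norm (F (fst z))) * (C * (norm (e (snd z)) * norm (f (snd z)))))"
        using C by (simp add: abs_mult mult_ac)
    qed
  qed
  have "(LINT x|M. (LINT y|M. f y *\<^sub>R k x y) \<bullet> F x) = (LINT x|M. LINT y|M. f y * (k x y \<bullet> F x))"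
  proof (rule Bochner_Integration.integral_cong[OF refl])
    fix x assume x: "x \<in> space M"
    show "(LINT y|M. f y *\<^sub>R k x y) \<bullet> F x = (LINT y|M. f y * (k x y \<bullet> F x))"
      using dominated_kernel_integrable[OF f x] by (simp flip: integral_inner_left)
  qed
  also have "\<dots> = (LINT y|M. LINT x|M. f y * (k x y \<bullet> F x))"
    by (rule Fubini_integral[OF int, symmetric])
  finally show ?thesis by simp
qed

end

section \<open>The multiplicative Haar measure on the unit interval\<close>

lemma space_mult_haar [simp]: "space mult_haar = {0<..<1}"
  by (simp add: mult_haar_def space_restrict_space)

lemma sets_mult_haar: "sets mult_haar = sets (restrict_space borel {0<..<1})"
  unfolding mult_haar_def sets_density by (intro sets_restrict_space_cong) simp

lemma measurable_mult_haar:
  assumes "f \<in> borel_measurable borel"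
  shows "f \<in> borel_measurable mult_haar"
  unfolding measurable_cong_sets[OF sets_mult_haar refl]
  by (rule measurable_restrict_space1[OF assms])

lemma measurable_mult_haar_pair:
  assumes "f \<in> borel_measurable (borel \<Otimes>\<^sub>M borel)"
  shows "f \<in> borel_measurable (mult_haar \<Otimes>\<^sub>M mult_haar)"
proof -
  have "(\<lambda>x. x) \<in> mult_haar \<rightarrow>\<^sub>M borel" by (rule measurable_mult_haar) simp
  then have "(\<lambda>z. (fst z, snd z)) \<in> mult_haar \<Otimes>\<^sub>M mult_haar \<rightarrow>\<^sub>M borel \<Otimes>\<^sub>M borel"
    by measurable
  from measurable_compose[OF this assms] show ?thesis by simp
qed

lemma sigma_finite_mult_haar: "sigma_finite_measure mult_haar"
proof -
  have "sigma_finite_measure (restrict_space lborel {0<..<1::real})"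
    by (rule sigma_finite_measure_restrict_space) (auto intro: lborel.sigma_finite_measure_axioms)
  moreover have "(\<lambda>x. ennreal (1 / x)) \<in> borel_measurable (restrict_space lborel {0<..<1::real})"
    by (rule measurable_restrict_space1) simp
  ultimately show ?thesis
    unfolding mult_haar_def
    by (subst sigma_finite_measure.sigma_finite_iff_density_finite) auto
qed

lemma
  fixes f :: "real \<Rightarrow> real"
  assumes f: "f \<in> borel_measurable borel"
  shows integrable_mult_haar:
      "integrable mult_haar f \<longleftrightarrow> set_integrable lborel {0<..<1} (\<lambda>x. f x / x)"
    and integral_mult_haar: "(LINT x|mult_haar. f x) = (LINT x:{0<..<1}|lborel. f x / x)"
proof -
  let ?R = "restrict_space lborel {0<..<1::real}"
  have m: "f \<in> borel_measurable ?R" "(\<lambda>x. 1 / x) \<in> borel_measurable ?R"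
    using f by (auto intro: measurable_restrict_space1)
  have nonneg: "AE x in ?R. 0 \<le> 1 / x"
    by (rule AE_I2) (simp add: space_restrict_space)
  show "integrable mult_haar f \<longleftrightarrow> set_integrable lborel {0<..<1} (\<lambda>x. f x / x)"
    unfolding mult_haar_def
    by (subst integrable_density[OF m nonneg])
      (simp add: integrable_restrict_space set_integrable_def)
  show "(LINT x|mult_haar. f x) = (LINT x:{0<..<1}|lborel. f x / x)"
    unfolding mult_haar_def
    by (subst integral_density[OF m nonneg])
      (simp add: integral_restrict_space set_lebesgue_integral_def)
qed

lemma AE_mult_haar_neq: "AE y in mult_haar. y \<noteq> x"
proof -
  have "AE y in lborel. y \<noteq> x" by (rule AE_lborel_singleton)
  then have "AE y in restrict_space lborel {0<..<1}. y \<noteq> x"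
    by (subst AE_restrict_space_iff) auto
  then show ?thesis
    unfolding mult_haar_def
    by (subst AE_density) (auto intro: measurable_restrict_space1)
qed

lemma sqrt_in_L2_mult_haar: "sqrt \<in> L2_space mult_haar"
proof -
  have "set_integrable lborel {0<..<1} (\<lambda>x::real. 1::real)"
    unfolding set_integrable_def by simp
  also have "?this \<longleftrightarrow> set_integrable lborel {0<..<1} (\<lambda>x::real. x / x)"
    by (rule set_integrable_cong) auto
  finally have "integrable mult_haar (\<lambda>x. x)"
    by (subst integrable_mult_haar) auto
  also have "?this \<longleftrightarrow> integrable mult_haar (\<lambda>x. (norm (sqrt x))\<^sup>2)"
    by (rule Bochner_Integration.integrable_cong) auto
  finally show ?thesis
    by (auto simp: L2_space_def intro!: measurable_mult_haar)
qed

section \<open>Integral operators\<close>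

lemma bounded_kernel_op_dominated:
  assumes sf: "sigma_finite_measure M" and e: "e \<in> L2_space M" and C: "0 \<le> C"
    and k: "dominated_kernel M e C k"
  shows "bounded_kernel_op M k"
  unfolding bounded_kernel_op_def
proof (intro conjI exI ballI)
  note facts = dominated_kernel_apply_L2[OF sf e C k]
  fix f :: "'a \<Rightarrow> real" assume f: "f \<in> L2_space M"
  show "AE x in M. integrable M (\<lambda>y. k x y * f y)"
    using dominated_kernel_integrable[OF sf e C k f] by (auto simp: mult.commute)
  show "kernel_op M k f \<in> L2_space M"
    using facts(1)[OF f] by (simp add: kernel_op_def[abs_def] mult.commute)
  show "L2_nrm M (kernel_op M k f) \<le> (C * (L2_nrm M e)\<^sup>2) * L2_nrm M f"
    using facts(2)[OF f] by (simp add: kernel_op_def[abs_def] mult.commute)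
qed (rule dominated_kernel_measurable[OF sf e C k])

lemma symmetric_kernel_op:
  assumes sf: "sigma_finite_measure M" and e: "e \<in> L2_space M" and C: "0 \<le> C"
    and k: "dominated_kernel M e C k" and sym: "\<And>x y. k x y = k y x"
    and f: "f \<in> L2_space M" and g: "g \<in> L2_space M"
  shows "L2_inner M (kernel_op M k f) g = L2_inner M f (kernel_op M k g)"
proof -
  have "L2_inner M (kernel_op M k f) g = (LINT y|M. f y * (LINT x|M. k x y * g x))"
    using dominated_kernel_transpose_integral[OF sf e C k f g]
    by (simp add: L2_inner_def kernel_op_def mult.commute)
  then show ?thesis using sym by (simp add: L2_inner_def kernel_op_def)
qed

text \<open>
  A kernel that is separable off the diagonal is of trace class if points are null sets: the
  integral does not see the diagonal, and the operator has finite rank.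
\<close>

lemma trace_class_separable_kernel:
  fixes M :: "'a measure" and a b :: "nat \<Rightarrow> 'a \<Rightarrow> real" and k :: "'a \<Rightarrow> 'a \<Rightarrow> real"
  assumes diag: "\<And>x. AE y in M. y \<noteq> x"
    and a: "\<And>i. i < m \<Longrightarrow> a i \<in> L2_space M" and b: "\<And>i. i < m \<Longrightarrow> b i \<in> L2_space M"
    and meas: "(\<lambda>z. k (fst z) (snd z)) \<in> borel_measurable (M \<Otimes>\<^sub>M M)"
    and k: "\<And>x y. x \<in> space M \<Longrightarrow> y \<in> space M \<Longrightarrow> y \<noteq> x \<Longrightarrow> k x y = (\<Sum>i<m. b i x * a i y)"
    and op: "\<And>f. f \<in> L2_space M \<Longrightarrow> kernel_op M k f \<in> L2_space M"
  shows "trace_class M (kernel_op M k)"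
proof -
  define a' b' where "a' i = (if i < m then a i else (\<lambda>x. 0))"
    and "b' i = (if i < m then b i else (\<lambda>x. 0))" for i
  have L2: "a' i \<in> L2_space M" "b' i \<in> L2_space M" for i
    using a b by (auto simp: a'_def b'_def L2_space_def)
  have eq: "kernel_op M k f x = (\<Sum>i<m. L2_inner M (a i) f * b i x)"
    if f: "f \<in> L2_space M" and x: "x \<in> space M" for f x
  proof -
    have [measurable]: "f \<in> borel_measurable M" using f by (simp add: L2_space_def)
    have [measurable]: "a i \<in> borel_measurable M" if "i < m" for i
      using a[OF that] by (simp add: L2_space_def)
    have km [measurable]: "(\<lambda>y. k x y) \<in> borel_measurable M"
      using measurable_compose[OF measurable_Pair1'[OF x] meas] by simp
    have "kernel_op M k f x = (LINT y|M. (\<Sum>i<m. b i x * (a i y * f y)))"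
      unfolding kernel_op_def
    proof (rule integral_cong_AE)
      show "AE y in M. k x y * f y = (\<Sum>i<m. b i x * (a i y * f y))"
        using diag[of x] AE_space
        by eventually_elim (simp add: k x sum_distrib_right mult.assoc)
    qed (auto intro!: borel_measurable_sum borel_measurable_times)
    also have "\<dots> = (\<Sum>i<m. b i x * (LINT y|M. a i y * f y))"
      using L2_integrable_inner[OF a f] by (subst Bochner_Integration.integral_sum) auto
    finally show ?thesis by (simp add: L2_inner_def mult.commute)
  qed
  show ?thesis
    unfolding trace_class_def
  proof (rule exI[of _ a'], rule exI[of _ b'], intro conjI allI ballI L2)
    show "summable (\<lambda>i. L2_nrm M (a' i) * L2_nrm M (b' i))"
      by (rule summable_finite[of "{..<m}"]) (auto simp: a'_def L2_nrm_def L2_inner_def)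
    fix f :: "'a \<Rightarrow> real" assume f: "f \<in> L2_space M"
    show "kernel_op M k f \<in> L2_space M" by (rule op[OF f])
    have "L2_nrm M (\<lambda>x. kernel_op M k f x - (\<Sum>i<l. L2_inner M (a' i) f * b' i x)) = 0"
      if "m \<le> l" for l
    proof -
      have "(\<Sum>i<l. L2_inner M (a' i) f * b' i x) = (\<Sum>i<m. L2_inner M (a i) f * b i x)" for x
        using that by (intro sum.mono_neutral_cong_right) (auto simp: a'_def b'_def)
      then have "kernel_op M k f x - (\<Sum>i<l. L2_inner M (a' i) f * b' i x) = 0"
        if "x \<in> space M" for x using eq[OF f that] by simp
      then have "(LINT x|M. (kernel_op M k f x - (\<Sum>i<l. L2_inner M (a' i) f * b' i x))
          * (kernel_op M k f x - (\<Sum>i<l. L2_inner M (a' i) f * b' i x))) = (LINT x|M. 0)"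
        by (intro Bochner_Integration.integral_cong) auto
      then show ?thesis by (simp add: L2_nrm_def L2_inner_def)
    qed
    then have "\<forall>\<^sub>F l in sequentially.
        L2_nrm M (\<lambda>x. kernel_op M k f x - (\<Sum>i<l. L2_inner M (a' i) f * b' i x)) = 0"
      using eventually_sequentially by blast
    then show "(\<lambda>l. L2_nrm M (\<lambda>x. kernel_op M k f x - (\<Sum>i<l. L2_inner M (a' i) f * b' i x)))
        \<longlonglongrightarrow> 0"
      by (rule tendsto_eventually)
  qed
qed

section \<open>Hankel operators whose symbols vanish like a square root\<close>

text \<open>The Hankel kernels are symmetric in \<open>x\<close> and \<open>t\<close>, so the adjoint has the same form.\<close>

definition hankel_adjoint ::
  "nat set \<Rightarrow> (nat \<Rightarrow> real \<Rightarrow> real^2) \<Rightarrow> (nat \<Rightarrow> real \<Rightarrow> real^2) \<Rightarrow> real \<Rightarrow> real" where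
  "hankel_adjoint I \<psi> F x = (\<Sum>k\<in>I. LINT t|mult_haar. \<psi> k (t * x) \<bullet> F k t)"

context
  fixes I :: "nat set" and \<psi> :: "nat \<Rightarrow> real \<Rightarrow> real^2" and C :: real
  assumes C: "0 \<le> C"
    and meas: "\<And>k. k \<in> I \<Longrightarrow> \<psi> k \<in> borel_measurable borel"
    and bound: "\<And>k x. k \<in> I \<Longrightarrow> 0 < x \<Longrightarrow> x < 1 \<Longrightarrow> norm (\<psi> k x) \<le> C * sqrt x"
begin

lemma hankel_dominated:
  assumes k: "k \<in> I"
  shows "dominated_kernel mult_haar sqrt C (\<lambda>x y. \<psi> k (x * y))"
  unfolding dominated_kernel_def
proof (intro conjI ballI)
  have [measurable]: "\<psi> k \<in> borel_measurable borel" by (rule meas[OF k])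
  show "(\<lambda>z. \<psi> k (fst z * snd z)) \<in> borel_measurable (mult_haar \<Otimes>\<^sub>M mult_haar)"
    by (rule measurable_mult_haar_pair) measurable
  fix x y :: real assume "x \<in> space mult_haar" "y \<in> space mult_haar"
  then have xy: "0 < x" "x < 1" "0 < y" "y < 1" by auto
  then have "0 < x * y" "x * y < 1" using mult_strict_mono[of x 1 y 1] by auto
  then have "norm (\<psi> k (x * y)) \<le> C * sqrt (x * y)" by (intro bound[OF k]) auto
  then show "norm (\<psi> k (x * y)) \<le> C * norm (sqrt x) * norm (sqrt y)"
    using xy by (simp add: real_sqrt_mult)
qed

lemmas haar_facts = sigma_finite_mult_haar sqrt_in_L2_mult_haar C

lemma hankel_L2: "k \<in> I \<Longrightarrow> f \<in> L2_space mult_haar \<Longrightarrow> hankel \<psi> f k \<in> L2_space mult_haar"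
  using dominated_kernel_apply_L2(1)[OF haar_facts hankel_dominated] by (simp add: hankel_def[abs_def])

lemma hankel_operator_sqrt_bound:
  assumes cont: "\<And>k. k \<in> I \<Longrightarrow> continuous_on {0<..<1} (\<psi> k)"
  shows "hankel_operator I \<psi>"
  unfolding hankel_operator_def
proof (intro conjI ballI exI)
  let ?c = "C * (L2_nrm mult_haar sqrt)\<^sup>2"
  fix f :: "real \<Rightarrow> real" assume f: "f \<in> L2_space mult_haar"
  show "AE x in mult_haar. integrable mult_haar (\<lambda>y. f y *\<^sub>R \<psi> k (x * y))" if "k \<in> I" for k
    using dominated_kernel_integrable[OF haar_facts hankel_dominated[OF that] f] by (intro AE_I2) blast
  show "hankel \<psi> f \<in> L2_blocks I mult_haar"
    using hankel_L2[OF _ f] by (simp add: L2_blocks_def)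
  have "L2_inner mult_haar (hankel \<psi> f k) (hankel \<psi> f k) \<le> (?c * L2_nrm mult_haar f)\<^sup>2"
    if k: "k \<in> I" for k
  proof -
    have "L2_nrm mult_haar (hankel \<psi> f k) \<le> ?c * L2_nrm mult_haar f"
      using dominated_kernel_apply_L2(2)[OF haar_facts hankel_dominated[OF k] f]
      by (simp add: hankel_def[abs_def])
    then have "(L2_nrm mult_haar (hankel \<psi> f k))\<^sup>2 \<le> (?c * L2_nrm mult_haar f)\<^sup>2"
      by (intro power_mono L2_nrm_nonneg)
    then show ?thesis by (simp add: L2_nrm_def L2_inner_def)
  qed
  then have "L2_blocks_inner I mult_haar (hankel \<psi> f) (hankel \<psi> f)
      \<le> real (card I) * (?c * L2_nrm mult_haar f)\<^sup>2"
    unfolding L2_blocks_inner_def by (rule sum_bounded_above)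
  then have "sqrt (L2_blocks_inner I mult_haar (hankel \<psi> f) (hankel \<psi> f))
      \<le> sqrt (real (card I) * (?c * L2_nrm mult_haar f)\<^sup>2)"
    by (rule real_sqrt_le_mono)
  also have "\<dots> = (sqrt (real (card I)) * ?c) * L2_nrm mult_haar f"
    using C by (simp add: real_sqrt_mult L2_nrm_nonneg)
  finally show "sqrt (L2_blocks_inner I mult_haar (hankel \<psi> f) (hankel \<psi> f))
      \<le> (sqrt (real (card I)) * ?c) * L2_nrm mult_haar f" .
qed (rule cont)

lemma is_adjoint_hankel_adjoint: "is_adjoint I mult_haar (hankel \<psi>) (hankel_adjoint I \<psi>)"
  unfolding is_adjoint_def
proof (intro ballI conjI)
  fix F assume "F \<in> L2_blocks I mult_haar"
  then have F: "\<And>k. k \<in> I \<Longrightarrow> F k \<in> L2_space mult_haar" by (simp add: L2_blocks_def)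
  note L2 = dominated_kernel_transpose_apply_L2[OF haar_facts hankel_dominated F]
  show "hankel_adjoint I \<psi> F \<in> L2_space mult_haar"
    unfolding hankel_adjoint_def[abs_def] by (rule L2_space_sum) (rule L2)
  fix f :: "real \<Rightarrow> real" assume f: "f \<in> L2_space mult_haar"
  have "L2_blocks_inner I mult_haar (hankel \<psi> f) F
      = (\<Sum>k\<in>I. LINT y|mult_haar. f y * (LINT x|mult_haar. \<psi> k (x * y) \<bullet> F k x))"
    unfolding L2_blocks_inner_def L2_inner_def hankel_def
    by (intro sum.cong refl dominated_kernel_transpose_integral[OF haar_facts hankel_dominated f F])
  also have "\<dots> = (LINT y|mult_haar. (\<Sum>k\<in>I. f y * (LINT x|mult_haar. \<psi> k (x * y) \<bullet> F k x)))"
    using L2_integrable_inner[OF f L2] by (subst Bochner_Integration.integral_sum) auto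
  finally show "L2_blocks_inner I mult_haar (hankel \<psi> f) F
      = L2_inner mult_haar f (hankel_adjoint I \<psi> F)"
    by (simp add: L2_inner_def hankel_adjoint_def sum_distrib_left)
qed

lemma dilated_symbol_L2:
  assumes k: "k \<in> I" and x: "0 < x" "x < 1"
  shows "(\<lambda>t. \<psi> k (t * x)) \<in> L2_space mult_haar"
proof (rule L2_space_dominated[OF sqrt_in_L2_mult_haar, where c = "C * sqrt x"])
  have [measurable]: "\<psi> k \<in> borel_measurable borel" by (rule meas[OF k])
  show "(\<lambda>t. \<psi> k (t * x)) \<in> borel_measurable mult_haar"
    by (rule measurable_mult_haar) measurable
  show "norm (\<psi> k (t * x)) \<le> C * sqrt x * norm (sqrt t)" if "t \<in> space mult_haar" for t
    using hankel_dominated[OF k] that x by (simp add: dominated_kernel_def mult_ac)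
qed

text \<open>
  Fubini's theorem turns \<open>\<Gamma>\<^sup>\<dagger> \<sigma> \<Gamma>\<close> into the integral operator whose kernel is the integral over
  \<open>t\<close> of the rank one kernels below.
\<close>

lemma kernel_op_eq_hankel_product:
  assumes K: "\<And>x y. 0 < x \<Longrightarrow> x < 1 \<Longrightarrow> 0 < y \<Longrightarrow> y < 1 \<Longrightarrow> y \<noteq> x \<Longrightarrow>
      K x y = (\<Sum>k\<in>I. LINT t|mult_haar. \<psi> k (t * x) \<bullet> (\<sigma> k *v \<psi> k (t * y)))"
    and K_meas: "(\<lambda>z. K (fst z) (snd z)) \<in> borel_measurable (mult_haar \<Otimes>\<^sub>M mult_haar)"
    and f: "f \<in> L2_space mult_haar" and x: "0 < x" "x < 1"
  shows "kernel_op mult_haar K f x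
    = hankel_adjoint I \<psi> (\<lambda>k s. \<sigma> k *v hankel \<psi> f k s) x"
proof -
  have swap: "\<psi> k s \<bullet> (\<sigma> k *v v) = v \<bullet> (transpose (\<sigma> k) *v \<psi> k s)" for k s v
    by (metis dot_lmul_matrix inner_commute transpose_matrix_vector)
  have F: "(\<lambda>t. transpose (\<sigma> k) *v \<psi> k (t * x)) \<in> L2_space mult_haar" if k: "k \<in> I" for k
    by (rule L2_space_bounded_linear[OF matrix_vector_mul_bounded_linear dilated_symbol_L2[OF k x]])
  let ?g = "\<lambda>k y. LINT t|mult_haar. \<psi> k (t * x) \<bullet> (\<sigma> k *v \<psi> k (t * y))"
  have L2: "?g k \<in> L2_space mult_haar" if "k \<in> I" for k
    using dominated_kernel_transpose_apply_L2[OF haar_facts hankel_dominated F, OF that that] by (simp add: swap)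
  have block_eq: "(LINT t|mult_haar. \<psi> k (t * x) \<bullet> (\<sigma> k *v hankel \<psi> f k t))
      = (LINT y|mult_haar. f y * ?g k y)" if k: "k \<in> I" for k
    using dominated_kernel_transpose_integral[OF haar_facts hankel_dominated[OF k] f F[OF k]]
    by (simp add: swap hankel_def)
  have [measurable]: "f \<in> borel_measurable mult_haar"
    and g [measurable]: "\<And>k. k \<in> I \<Longrightarrow> ?g k \<in> borel_measurable mult_haar"
    using f L2 by (auto simp: L2_space_def)
  have [measurable]: "(\<lambda>y. K x y) \<in> borel_measurable mult_haar"
    using measurable_compose[OF measurable_Pair1' K_meas] x by simp
  have "kernel_op mult_haar K f x = (LINT y|mult_haar. (\<Sum>k\<in>I. f y * ?g k y))"
    unfolding kernel_op_def
  proof (rule integral_cong_AE)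
    show "AE y in mult_haar. K x y * f y = (\<Sum>k\<in>I. f y * ?g k y)"
      using AE_mult_haar_neq[of x] AE_space
      by eventually_elim (simp add: K x sum_distrib_left mult.commute[of _ "f _"])
  qed (auto intro!: borel_measurable_sum borel_measurable_times g)
  also have "\<dots> = (\<Sum>k\<in>I. LINT y|mult_haar. f y * ?g k y)"
    using L2_integrable_inner[OF f L2] by (subst Bochner_Integration.integral_sum) auto
  finally show ?thesis by (simp add: hankel_adjoint_def block_eq)
qed

end

text \<open>Testing \<open>\<sigma>\<close> on vectors that are supported in one block shows that each block is nonnegative.\<close>

lemma nonneg_block_diag_imp_nonneg_form:
  assumes fin: "finite I" and \<sigma>: "nonneg_block_diag I \<sigma>"
  shows "0 \<le> L2_blocks_inner I mult_haar (hankel \<psi> f) (\<lambda>k s. \<sigma> k *v hankel \<psi> f k s)"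
  unfolding L2_blocks_inner_def
proof (rule sum_nonneg)
  fix k assume k: "k \<in> I"
  have "0 \<le> v \<bullet> (\<sigma> k *v v)" for v
  proof -
    have "0 \<le> (\<Sum>i\<in>I. (if i = k then v else 0) \<bullet> (\<sigma> i *v (if i = k then v else 0)))"
      using \<sigma>[unfolded nonneg_block_diag_def, THEN spec, of "\<lambda>i. if i = k then v else 0"]
      by simp
    also have "\<dots> = (\<Sum>i\<in>I. if i = k then v \<bullet> (\<sigma> k *v v) else 0)"
      by (rule sum.cong) auto
    finally show ?thesis using fin k by simp
  qed
  then show "0 \<le> L2_inner mult_haar (hankel \<psi> f k) (\<lambda>s. \<sigma> k *v hankel \<psi> f k s)"
    by (simp add: L2_inner_def)
qed

section \<open>The explicit solution\<close>

text \<open>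
  Up to a constant factor, \<open>\<bar>w\<bar>\<^sup>1\<^sup>/\<^sup>2\<close>, the fourth root of \<open>\<bar>\<Prod>\<^sub>j (x - \<delta>\<^sub>j)\<bar>\<close>. As an eighth root of the
  square it is differentiable off the zeros whatever the sign of the product, and continuous
  everywhere.
\<close>

definition w_root :: "nat \<Rightarrow> (nat \<Rightarrow> real) \<Rightarrow> real \<Rightarrow> real" where
  "w_root N \<delta> x = ((\<Prod>j=1..4*N-2. (x - \<delta> j))\<^sup>2) powr (1 / 8)"

definition poly_vec :: "real poly \<Rightarrow> real poly \<Rightarrow> real \<Rightarrow> real^2" where
  "poly_vec a b x = poly a x *\<^sub>R axis 1 1 + poly b x *\<^sub>R axis 2 1"

lemma poly_vec_nth [simp]: "poly_vec a b x $ 1 = poly a x" "poly_vec a b x $ 2 = poly b x"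
  by (simp_all add: poly_vec_def axis_def)

lemma continuous_on_poly_vec: "continuous_on S (poly_vec a b)"
  unfolding poly_vec_def[abs_def] by (intro continuous_intros)

lemma poly_vec_derivative:
  "(poly_vec a b has_vector_derivative poly_vec (pderiv a) (pderiv b) x) (at x)"
proof -
  have "((\<lambda>x. poly a x *\<^sub>R axis 1 1 + poly b x *\<^sub>R axis 2 (1::real))
      has_vector_derivative (poly a x *\<^sub>R 0 + poly (pderiv a) x *\<^sub>R axis 1 1)
        + (poly b x *\<^sub>R 0 + poly (pderiv b) x *\<^sub>R axis 2 1)) (at x)"
    by (intro has_vector_derivative_add has_vector_derivative_scaleR poly_DERIV
        has_vector_derivative_const)
  then show ?thesis by (simp add: poly_vec_def[abs_def])
qed

lemma continuous_on_w_root: "continuous_on S (w_root N \<delta>)"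
  unfolding w_root_def[abs_def] by (intro continuous_on_powr' continuous_intros) auto

lemma w_root_zero: "j \<in> {1..4*N-2} \<Longrightarrow> w_root N \<delta> (\<delta> j) = 0"
  by (auto simp: w_root_def)

lemma w_root_pos:
  assumes "\<And>j. j \<in> {1..4*N-2} \<Longrightarrow> x \<noteq> \<delta> j"
  shows "0 < w_root N \<delta> x"
proof -
  have "(\<Prod>j=1..4*N-2. (x - \<delta> j)) \<noteq> 0" using assms by (auto simp: prod_zero_iff)
  then show ?thesis by (simp add: w_root_def)
qed

lemma w_root_derivative:
  assumes x: "\<And>j. j \<in> {1..4*N-2} \<Longrightarrow> x \<noteq> \<delta> j"
  shows "(w_root N \<delta> has_real_derivative w_root N \<delta> x * (1 / 4 * (\<Sum>j=1..4*N-2. 1 / (x - \<delta> j)))) (at x)"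
proof -
  let ?P = "\<lambda>x. \<Prod>j=1..4*N-2. (x - \<delta> j)" and ?S = "\<Sum>j=1..4*N-2. 1 / (x - \<delta> j)"
  have nz: "?P x \<noteq> 0" using x by (auto simp: prod_zero_iff)
  have "(?P has_real_derivative ?P x * ?S) (at x)"
    by (rule has_field_derivative_prod') (use x in \<open>auto intro!: derivative_eq_intros\<close>)
  then have sq: "((\<lambda>x. (?P x)\<^sup>2) has_real_derivative 2 * ?P x * (?P x * ?S)) (at x)"
    by (auto intro!: derivative_eq_intros)
  have pos: "0 < (?P x)\<^sup>2" using nz by (rule zero_less_power2[THEN iffD2])
  have "((\<lambda>x. ((?P x)\<^sup>2) powr (1/8)) has_real_derivative
      (1 / 8 * ((?P x)\<^sup>2) powr (1 / 8 - 1)) * (2 * ?P x * (?P x * ?S))) (at x)"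
    by (rule DERIV_chain2[OF has_real_derivative_powr[OF pos] sq])
  also have "(1 / 8 * ((?P x)\<^sup>2) powr (1 / 8 - 1)) * (2 * ?P x * (?P x * ?S))
      = w_root N \<delta> x * (1 / 4 * ?S)"
  proof -
    have "((?P x)\<^sup>2) powr (1 / 8 - 1) = ((?P x)\<^sup>2) powr (1 / 8) / (?P x)\<^sup>2"
      unfolding powr_diff using pos by simp
    then show ?thesis
      unfolding w_root_def using nz by (simp add: power2_eq_square field_simps del: powr_mult)
  qed
  finally show ?thesis by (simp add: w_root_def[abs_def])
qed

definition wave_solution :: "nat \<Rightarrow> (nat \<Rightarrow> real) \<Rightarrow> real poly \<Rightarrow> real poly \<Rightarrow> real \<Rightarrow> real^2" where
  "wave_solution N \<delta> a b x = w_root N \<delta> x *\<^sub>R poly_vec a b x"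

lemma continuous_on_wave_solution: "continuous_on S (wave_solution N \<delta> a b)"
  unfolding wave_solution_def[abs_def]
  by (intro continuous_intros continuous_on_w_root continuous_on_poly_vec)

lemma trace_traceless: "trace (traceless a) = 0"
  by (simp add: traceless_def trace_def sum_2 mat_def)

lemma traceless_mult_vector: "traceless a *v v = a *v v + (- (1 / 2) * trace a) *\<^sub>R v"
  by (simp add: traceless_def vec_eq_iff matrix_vector_mult_22 forall_2 mat_def algebra_simps)

lemma B_mat_mult_vector: "B_mat N \<delta> \<beta> x *v v = (\<Sum>j=1..4*N-2. (1 / (x - \<delta> j)) *\<^sub>R (\<beta> j *v v))"
  unfolding B_mat_def
  by (induction rule: infinite_finite_induct[of _ "{1..4*N-2}"])
    (simp_all add: matrix_vector_mult_add_rdistrib scaleR_matrix_vector_assoc)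

text \<open>
  The scalar factor contributes \<open>\<onequarter> \<Sum>\<^sub>j 1 / (x - \<delta>\<^sub>j)\<close>, which is exactly what passing from the
  residues \<open>\<alpha>\<^sub>j\<close> to their traceless parts adds to the coefficient matrix.
\<close>

lemma wave_solution_derivative:
  assumes x: "\<And>j. j \<in> {1..4*N-2} \<Longrightarrow> x \<noteq> \<delta> j"
    and \<beta>: "\<And>j. j \<in> {1..4*N-2} \<Longrightarrow> \<beta> j = traceless (\<alpha> j)"
    and trace_sum: "(\<Sum>j=1..4*N-2. trace (\<alpha> j) / (x - \<delta> j)) = - (1/2) * (\<Sum>j=1..4*N-2. 1 / (x - \<delta> j))"
    and column: "\<And>i. (\<Sum>j=1..4*N-2. (\<alpha> j *v poly_vec a b x) $ i / (x - \<delta> j))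
      = poly_vec (pderiv a) (pderiv b) x $ i"
  shows "(wave_solution N \<delta> a b has_vector_derivative B_mat N \<delta> \<beta> x *v wave_solution N \<delta> a b x) (at x)"
proof -
  let ?q = "poly_vec a b x" and ?q' = "poly_vec (pderiv a) (pderiv b) x" and ?s = "w_root N \<delta> x"
  let ?S = "\<Sum>j=1..4*N-2. 1 / (x - \<delta> j)"
  have split: "(1 / d) *\<^sub>R (A + (- (1 / 2) * r) *\<^sub>R ?q) = (1 / d) *\<^sub>R A + (- (1 / 2) * (r / d)) *\<^sub>R ?q"
    for d r A by (simp add: scaleR_diff_right)
  have "(\<Sum>j=1..4*N-2. (1 / (x - \<delta> j)) *\<^sub>R (\<beta> j *v ?q))
      = (\<Sum>j=1..4*N-2. (1 / (x - \<delta> j)) *\<^sub>R (\<alpha> j *v ?q)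
      + (- (1 / 2) * (trace (\<alpha> j) / (x - \<delta> j))) *\<^sub>R ?q)"
    by (intro sum.cong refl) (simp only: \<beta> traceless_mult_vector split)
  also have "\<dots> = (\<Sum>j=1..4*N-2. (1 / (x - \<delta> j)) *\<^sub>R (\<alpha> j *v ?q))
      + (- (1 / 2) * (\<Sum>j=1..4*N-2. trace (\<alpha> j) / (x - \<delta> j))) *\<^sub>R ?q"
    by (simp only: sum.distrib sum_distrib_left scaleR_left.sum)
  also have "(\<Sum>j=1..4*N-2. (1 / (x - \<delta> j)) *\<^sub>R (\<alpha> j *v ?q)) = ?q'"
    by (simp add: vec_eq_iff column[symmetric])
  finally have B: "B_mat N \<delta> \<beta> x *v ?q = ?q' + (1 / 4 * ?S) *\<^sub>R ?q"
    unfolding B_mat_mult_vector trace_sum by simp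
  have "((\<lambda>x. w_root N \<delta> x *\<^sub>R poly_vec a b x) has_vector_derivative
      ?s *\<^sub>R ?q' + (?s * (1 / 4 * ?S)) *\<^sub>R ?q) (at x)"
    by (intro has_vector_derivative_scaleR w_root_derivative x poly_vec_derivative)
  also have "?s *\<^sub>R ?q' + (?s * (1 / 4 * ?S)) *\<^sub>R ?q = B_mat N \<delta> \<beta> x *v wave_solution N \<delta> a b x"
    by (simp add: wave_solution_def matrix_vector_mult_scaleR B scaleR_add_right)
  finally show ?thesis by (simp add: wave_solution_def[abs_def])
qed

section \<open>Factorization of the kernel\<close>

text \<open>
  A traceless matrix \<open>\<beta>\<close> belongs to the Lie algebra of the symplectic group of \<open>J\<close>, which means that
  \<open>J \<beta>\<close> is symmetric.
\<close>

lemma traceless_J_antisymmetry: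
  assumes "trace \<beta> = 0"
  shows "(\<beta> *v v) \<bullet> (J *v w) = - (v \<bullet> ((J ** \<beta>) *v w))"
    and "v \<bullet> ((J ** \<beta>) *v w) = w \<bullet> ((J ** \<beta>) *v v)"
    and "v \<bullet> (J *v (\<beta> *v w)) = v \<bullet> ((J ** \<beta>) *v w)"
proof -
  have "\<beta> $ 2 $ 2 = - \<beta> $ 1 $ 1" using assms by (simp add: trace_def sum_2 add_eq_0_iff2)
  then show "(\<beta> *v v) \<bullet> (J *v w) = - (v \<bullet> ((J ** \<beta>) *v w))"
    and "v \<bullet> ((J ** \<beta>) *v w) = w \<bullet> ((J ** \<beta>) *v v)"
    and "v \<bullet> (J *v (\<beta> *v w)) = v \<bullet> ((J ** \<beta>) *v w)"
    by (simp_all add: inner_vec_def sum_2 matrix_vector_mult_22 matrix_mult_22 J_def algebra_simps)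
qed

lemma has_real_derivative_inner_scaled:
  fixes Z :: "real \<Rightarrow> real^2" and A :: "real^2^2"
  assumes Zy: "(Z has_vector_derivative Dy) (at (t * y))" and Zx: "(Z has_vector_derivative Dx) (at (t * x))"
  shows "((\<lambda>t. Z (t * y) \<bullet> (A *v Z (t * x))) has_real_derivative
    Z (t * y) \<bullet> (A *v (x *\<^sub>R Dx)) + (y *\<^sub>R Dy) \<bullet> (A *v Z (t * x))) (at t)"
proof -
  have "((\<lambda>t. Z (t * u)) has_vector_derivative u *\<^sub>R D) (at t)"
    if "(Z has_vector_derivative D) (at (t * u))" for u D
  proof -
    have "((\<lambda>t. t * u) has_vector_derivative u) (at t)" by (auto intro!: derivative_eq_intros)
    from vector_diff_chain_at[OF this that] show ?thesis by (simp add: o_def)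
  qed
  note y = this[OF Zy, unfolded has_vector_derivative_def]
    and x = bounded_linear.has_vector_derivative[OF matrix_vector_mul_bounded_linear[of A] this[OF Zx],
      unfolded has_vector_derivative_def]
  show ?thesis
    unfolding has_field_derivative_def
    by (rule has_derivative_eq_rhs[OF has_derivative_inner[OF y x]]) (simp add: fun_eq_iff algebra_simps)
qed

text \<open>
  A zero that coincides with \<open>\<delta>\<^sub>1 = 0\<close> contributes nothing to the kernel, so its symbol can be set to
  0; the general formula would divide by zero at the end of the interval.
\<close>

definition hankel_symbol :: "(nat \<Rightarrow> real) \<Rightarrow> (nat \<Rightarrow> real^2^2) \<Rightarrow> (real \<Rightarrow> real^2) \<Rightarrow> nat \<Rightarrow> real \<Rightarrow> real^2" where
  "hankel_symbol \<delta> C Z k x = (if \<delta> k = 0 then 0 else (sqrt x / (x - \<delta> k)) *\<^sub>R (C k *v Z x))"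

context
  fixes N :: nat and \<delta> :: "nat \<Rightarrow> real" and \<beta> C \<sigma> :: "nat \<Rightarrow> real^2^2" and Z :: "real \<Rightarrow> real^2"
  assumes \<delta>1: "\<delta> 1 = 0"
    and \<delta>: "\<And>j. j \<in> {1..4*N-2} \<Longrightarrow> \<delta> j \<notin> {0<..1}"
    and \<beta>: "\<And>j. j \<in> {1..4*N-2} \<Longrightarrow> trace (\<beta> j) = 0"
    and Z: "\<And>x. 0 < x \<Longrightarrow> x < 1 \<Longrightarrow> (Z has_vector_derivative B_mat N \<delta> \<beta> x *v Z x) (at x)"
    and Z_cont: "continuous_on UNIV Z" and Z0: "Z 0 = 0"
    and C: "\<And>k. k \<in> {2..4*N-2} \<Longrightarrow> (- \<delta> k) *\<^sub>R (J ** \<beta> k) = transpose (C k) ** \<sigma> k ** C k"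
begin

abbreviation psi where "psi \<equiv> hankel_symbol \<delta> C Z"

lemma continuous_on_C_Z: "continuous_on S (\<lambda>x. C k *v Z x)"
  by (intro bounded_linear.continuous_on[OF matrix_vector_mul_bounded_linear]
      continuous_on_subset[OF Z_cont]) auto

lemma hankel_symbol_bounded: "\<exists>c\<ge>0. \<forall>k\<in>{2..4*N-2}. \<forall>x. 0 < x \<longrightarrow> x < 1 \<longrightarrow> norm (psi k x) \<le> c * sqrt x"
proof -
  have "\<exists>c. \<forall>x. 0 < x \<longrightarrow> x < 1 \<longrightarrow> norm (psi k x) \<le> c * sqrt x" if k: "k \<in> {2..4*N-2}" for k
  proof (cases "\<delta> k = 0")
    case True then show ?thesis by (auto simp: hankel_symbol_def intro!: exI[of _ 0])
  next
    case False
    have "\<forall>x\<in>{0..1}. x - \<delta> k \<noteq> 0" using \<delta>[of k] k False by auto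
    then have "continuous_on {0..1} (\<lambda>x. (1 / (x - \<delta> k)) *\<^sub>R (C k *v Z x))"
      by (intro continuous_intros continuous_on_C_Z) auto
    then have "bounded ((\<lambda>x. (1 / (x - \<delta> k)) *\<^sub>R (C k *v Z x)) ` {0..1})"
      by (intro compact_imp_bounded compact_continuous_image) auto
    then obtain c where c: "\<forall>x\<in>{0..1}. norm ((1 / (x - \<delta> k)) *\<^sub>R (C k *v Z x)) \<le> c"
      by (auto simp: bounded_iff)
    have "norm (psi k x) \<le> c * sqrt x" if x: "0 < x" "x < 1" for x
    proof -
      have "psi k x = sqrt x *\<^sub>R ((1 / (x - \<delta> k)) *\<^sub>R (C k *v Z x))"
        using False by (simp add: hankel_symbol_def)
      then have "norm (psi k x) = sqrt x * norm ((1 / (x - \<delta> k)) *\<^sub>R (C k *v Z x))"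
        using x by (simp only: norm_scaleR) simp
      also have "\<dots> \<le> sqrt x * c" using c x by (intro mult_left_mono) auto
      finally show ?thesis by (simp add: mult.commute)
    qed
    then show ?thesis by blast
  qed
  then obtain c where c: "\<And>k x. k \<in> {2..4*N-2} \<Longrightarrow> 0 < x \<Longrightarrow> x < 1 \<Longrightarrow> norm (psi k x) \<le> c k * sqrt x"
    by metis
  have "norm (psi k x) \<le> (\<Sum>k\<in>{2..4*N-2}. \<bar>c k\<bar>) * sqrt x"
    if k: "k \<in> {2..4*N-2}" and x: "0 < x" "x < 1" for k x
  proof -
    have "c k \<le> \<bar>c k\<bar>" by simp
    also have "\<dots> \<le> (\<Sum>k\<in>{2..4*N-2}. \<bar>c k\<bar>)" using k by (intro member_le_sum) auto
    finally have "c k * sqrt x \<le> (\<Sum>k\<in>{2..4*N-2}. \<bar>c k\<bar>) * sqrt x"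
      using x by (intro mult_right_mono) auto
    then show ?thesis using c[OF k x] by linarith
  qed
  then show ?thesis by (intro exI[of _ "\<Sum>k\<in>{2..4*N-2}. \<bar>c k\<bar>"]) (auto intro: sum_nonneg)
qed

lemma hankel_symbol_measurable: "psi k \<in> borel_measurable borel"
proof -
  have [measurable]: "(\<lambda>x. C k *v Z x) \<in> borel_measurable borel"
    by (intro borel_measurable_continuous_onI continuous_on_C_Z)
  show ?thesis unfolding hankel_symbol_def[abs_def] by measurable
qed

lemma hankel_symbol_continuous:
  assumes k: "k \<in> {2..4*N-2}"
  shows "continuous_on {0<..<1} (psi k)"
proof -
  have "\<forall>x\<in>{0<..<1}. x - \<delta> k \<noteq> 0" using \<delta>[of k] k by auto
  then have "continuous_on {0<..<1} (\<lambda>x. (sqrt x / (x - \<delta> k)) *\<^sub>R (C k *v Z x))"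
    by (intro continuous_intros continuous_on_C_Z) auto
  then show ?thesis unfolding hankel_symbol_def[abs_def] by (cases "\<delta> k = 0") simp_all
qed

text \<open>
  The Euler operator \<open>x \<partial>\<^sub>x + y \<partial>\<^sub>y\<close> kills \<open>\<surd>(x y) / (x - y)\<close>, which is homogeneous of degree
  zero, and applied to \<open>Z(y)\<^sup>\<dagger> J Z(x)\<close> it gives \<open>Z(y)\<^sup>\<dagger> J (x B(x) - y B(y)) Z(x)\<close>. In this difference
  the pole at \<open>\<delta>\<^sub>1 = 0\<close> disappears and each other term has the factor \<open>x - y\<close>, which cancels the
  denominator and leaves a sum of products of functions of \<open>x\<close> and of \<open>y\<close>.
\<close>

lemma kernel_ray_derivative:
  assumes x: "0 < x" "x < 1" and y: "0 < y" "y < 1" and xy: "y \<noteq> x" and t: "0 < t" "t \<le> 1"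
  shows "((\<lambda>t. sqrt (x * y) / (x - y) * (Z (t * y) \<bullet> (J *v Z (t * x)))) has_real_derivative
    (\<Sum>k\<in>{2..4*N-2}. psi k (t * x) \<bullet> (\<sigma> k *v psi k (t * y))) / t) (at t)"
proof -
  let ?c = "sqrt (x * y) / (x - y)"
  have tx: "0 < t * x" "t * x < 1" and ty: "0 < t * y" "t * y < 1"
  proof -
    have "t * x \<le> x" "t * y \<le> y" using x y t by (simp_all add: mult_left_le_one_le)
    then show "t * x < 1" "t * y < 1" using x y by linarith+
  qed (use x y t in simp_all)
  let ?E = "\<lambda>j. Z (t * y) \<bullet> ((J ** \<beta> j) *v Z (t * x))"
  let ?d = "\<lambda>j. x / (t * x - \<delta> j) - y / (t * y - \<delta> j)"
  have bracket: "Z (t * y) \<bullet> (J *v (x *\<^sub>R (B_mat N \<delta> \<beta> (t * x) *v Z (t * x))))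
      + (y *\<^sub>R (B_mat N \<delta> \<beta> (t * y) *v Z (t * y))) \<bullet> (J *v Z (t * x))
      = (\<Sum>j=1..4*N-2. ?d j * ?E j)"
  proof -
    have "Z (t * y) \<bullet> (J *v (x *\<^sub>R (B_mat N \<delta> \<beta> (t * x) *v Z (t * x))))
      = (\<Sum>j=1..4*N-2. x / (t * x - \<delta> j) * ?E j)"
      unfolding B_mat_mult_vector matrix_vector_mult_scaleR
      by (simp add: vec.linear_sum[OF matrix_vector_mul_linear_gen] matrix_vector_mult_scaleR inner_sum_right
          sum_distrib_left traceless_J_antisymmetry(3)[OF \<beta>])
    moreover have "(y *\<^sub>R (B_mat N \<delta> \<beta> (t * y) *v Z (t * y))) \<bullet> (J *v Z (t * x))
      = (\<Sum>j=1..4*N-2. - (y / (t * y - \<delta> j) * ?E j))"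
      unfolding B_mat_mult_vector
      by (simp add: inner_sum_left sum_distrib_left traceless_J_antisymmetry(1)[OF \<beta>] del: sum_negf)
    ultimately show ?thesis by (simp add: sum.distrib[symmetric] left_diff_distrib)
  qed
  have "((\<lambda>t. ?c * (Z (t * y) \<bullet> (J *v Z (t * x)))) has_real_derivative ?c * (\<Sum>j=1..4*N-2. ?d j * ?E j)) (at t)"
    using has_real_derivative_inner_scaled[OF Z[OF ty] Z[OF tx], of J]
    unfolding bracket by (rule DERIV_cmult)
  also have "?c * (\<Sum>j=1..4*N-2. ?d j * ?E j)
      = (\<Sum>k\<in>{2..4*N-2}. psi k (t * x) \<bullet> (\<sigma> k *v psi k (t * y))) / t"
  proof -
    \<comment> \<open>Zeros at the origin drop out: they add the same constant to \<open>x B(x)\<close> and \<open>y B(y)\<close>.\<close>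
    have d0: "?d j = 0" if "\<delta> j = 0" for j using that x y t by simp
    have "(\<Sum>j=1..4*N-2. ?d j * ?E j) = (\<Sum>k\<in>{2..4*N-2}. ?d k * ?E k)"
    proof (rule sum.mono_neutral_right)
      show "\<forall>j\<in>{1..4*N-2} - {2..4*N-2}. ?d j * ?E j = 0"
      proof
        fix j assume "j \<in> {1..4*N-2} - {2..4*N-2}"
        then have "j = 1" by auto
        then show "?d j * ?E j = 0" using d0[of j] \<delta>1 by simp
      qed
    qed auto
    then have "?c * (\<Sum>j=1..4*N-2. ?d j * ?E j) = (\<Sum>k\<in>{2..4*N-2}. ?c * (?d k * ?E k))"
      by (simp only: sum_distrib_left)
    also have "\<dots> = (\<Sum>k\<in>{2..4*N-2}. (psi k (t * x) \<bullet> (\<sigma> k *v psi k (t * y))) / t)"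
    proof (rule sum.cong[OF refl])
      fix k assume k: "k \<in> {2..4*N-2}"
      show "?c * (?d k * ?E k) = (psi k (t * x) \<bullet> (\<sigma> k *v psi k (t * y))) / t"
      proof (cases "\<delta> k = 0")
        case True
        then show ?thesis using d0[of k] by (simp add: hankel_symbol_def)
      next
        case False
        have k1: "k \<in> {1..4*N-2}" using k by auto
        have nz: "t * x - \<delta> k \<noteq> 0" "t * y - \<delta> k \<noteq> 0"
          using \<delta>[OF k1] tx ty by (metis add_0 diff_eq_eq greaterThanAtMost_iff less_imp_le)+
        have "(C k *v Z (t * x)) \<bullet> (\<sigma> k *v (C k *v Z (t * y)))
            = Z (t * x) \<bullet> ((transpose (C k) ** \<sigma> k ** C k) *v Z (t * y))"
          by (metis dot_lmul_matrix matrix_vector_mul_assoc transpose_matrix_vector transpose_transpose)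
        also have "\<dots> = - \<delta> k * ?E k"
          unfolding C[OF k, symmetric] scaleR_matrix_vector_assoc[symmetric] inner_scaleR_right
          by (simp only: traceless_J_antisymmetry(2)[OF \<beta>[OF k1], of "Z (t * x)"])
        finally have inner: "(C k *v Z (t * x)) \<bullet> (\<sigma> k *v (C k *v Z (t * y))) = - \<delta> k * ?E k" .
        have "psi k (t * x) \<bullet> (\<sigma> k *v psi k (t * y))
            = sqrt (t * x) / (t * x - \<delta> k) * (sqrt (t * y) / (t * y - \<delta> k)) * (- \<delta> k * ?E k)"
          using False unfolding hankel_symbol_def
          by (simp only: if_False matrix_vector_mult_scaleR inner_scaleR_left inner_scaleR_right inner
              mult.assoc) (rule mult.left_commute)
        also have "\<dots> = t * sqrt (x * y) * (- \<delta> k) / ((t * x - \<delta> k) * (t * y - \<delta> k)) * ?E k"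
          using t by (simp add: real_sqrt_mult)
        finally have rhs: "(psi k (t * x) \<bullet> (\<sigma> k *v psi k (t * y))) / t
            = sqrt (x * y) * (- \<delta> k) / ((t * x - \<delta> k) * (t * y - \<delta> k)) * ?E k"
          using t by simp
        have "?d k = \<delta> k * (y - x) / ((t * x - \<delta> k) * (t * y - \<delta> k))"
          using nz by (simp add: divide_simps) (simp add: algebra_simps)
        then have "?c * ?d k = sqrt (x * y) * (- \<delta> k) / ((t * x - \<delta> k) * (t * y - \<delta> k))"
          using xy by (simp add: divide_simps) (simp add: algebra_simps)
        then show ?thesis unfolding rhs by (simp only: mult.assoc[symmetric])
      qed
    qed
    finally show ?thesis by (simp only: sum_divide_distrib)
  qed
  finally show ?thesis .
qed

text \<open>
  The fundamental theorem of calculus along the ray; at \<open>t = 0\<close> the boundary term vanishes because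
  \<open>Z\<close> does.
\<close>

lemma kernel_eq_symbol_integral:
  assumes x: "0 < x" "x < 1" and y: "0 < y" "y < 1" and xy: "y \<noteq> x"
  shows "K_kernel Z x y
    = (\<Sum>k\<in>{2..4*N-2}. LINT t|mult_haar. psi k (t * x) \<bullet> (\<sigma> k *v psi k (t * y)))"
proof -
  let ?F = "\<lambda>t. sqrt (x * y) / (x - y) * (Z (t * y) \<bullet> (J *v Z (t * x)))"
  let ?g = "\<lambda>t. \<Sum>k\<in>{2..4*N-2}. psi k (t * x) \<bullet> (\<sigma> k *v psi k (t * y))"
  obtain c where c: "0 \<le> c" "\<And>k x. k \<in> {2..4*N-2} \<Longrightarrow> 0 < x \<Longrightarrow> x < 1 \<Longrightarrow> norm (psi k x) \<le> c * sqrt x"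
    using hankel_symbol_bounded by blast
  have L2: "(\<lambda>t. psi k (t * u)) \<in> L2_space mult_haar"
    if "k \<in> {2..4*N-2}" "0 < u" "u < 1" for k u
    by (rule dilated_symbol_L2[OF c(1) hankel_symbol_measurable c(2) that])
  have int: "integrable mult_haar (\<lambda>t. psi k (t * x) \<bullet> (\<sigma> k *v psi k (t * y)))"
    if "k \<in> {2..4*N-2}" for k
    by (intro L2_integrable_inner L2_space_bounded_linear[OF matrix_vector_mul_bounded_linear]
        L2 that x y)
  have gm: "?g \<in> borel_measurable borel"
  proof -
    have [measurable]: "psi k \<in> borel_measurable borel" for k by (rule hankel_symbol_measurable)
    have [measurable]: "(\<lambda>v. \<sigma> k *v v) \<in> borel_measurable borel" for k
      by (intro borel_measurable_continuous_onI linear_continuous_on matrix_vector_mul_bounded_linear)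
    show ?thesis by measurable
  qed
  have "integrable mult_haar ?g" by (rule Bochner_Integration.integrable_sum) (rule int)
  then have set_int: "set_integrable lborel {0<..<1} (\<lambda>t. ?g t / t)"
    by (simp only: integrable_mult_haar[OF gm])
  have F_cont: "continuous_on UNIV ?F"
    by (intro continuous_intros bounded_linear.continuous_on[OF matrix_vector_mul_bounded_linear]
        continuous_on_compose2[OF Z_cont]) auto
  have "(LBINT t=ereal 0..ereal 1. ?g t / t) = ?F 1 - ?F 0"
  proof (rule interval_integral_FTC_integrable)
    fix t assume "ereal 0 < ereal t" "ereal t < ereal 1"
    then have t: "0 < t" "t < 1" by auto
    show "(?F has_vector_derivative ?g t / t) (at t)"
      unfolding has_real_derivative_iff_has_vector_derivative[symmetric]
      by (rule kernel_ray_derivative) (use x y xy t in auto)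
    have lim: "((\<lambda>t. psi k (t * u)) \<longlongrightarrow> psi k (t * u)) (at t)"
      if k: "k \<in> {2..4*N-2}" and u: "0 < u" "u < 1" for k u
    proof -
      have "0 < t * u" "t * u < 1" using mult_strict_mono[of t 1 u 1] t u by simp_all
      then have "isCont (psi k) (t * u)"
        using hankel_symbol_continuous[OF k] by (simp add: continuous_on_eq_continuous_at)
      moreover have "((\<lambda>t. t * u) \<longlongrightarrow> t * u) (at t)" by (intro tendsto_intros)
      ultimately show ?thesis by (rule isCont_tendsto_compose)
    qed
    have "((\<lambda>t. psi k (t * x) \<bullet> (\<sigma> k *v psi k (t * y))) \<longlongrightarrow> psi k (t * x) \<bullet> (\<sigma> k *v psi k (t * y))) (at t)"
      if k: "k \<in> {2..4*N-2}" for k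
      by (rule tendsto_inner[OF lim[OF k x]
            bounded_linear.tendsto[OF matrix_vector_mul_bounded_linear lim[OF k y]]])
    then have "(?g \<longlongrightarrow> ?g t) (at t)" by (rule tendsto_sum)
    then show "isCont (\<lambda>t. ?g t / t) t"
      unfolding isCont_def using t by (intro tendsto_divide tendsto_ident_at) auto
  next
    show "set_integrable lborel (einterval (ereal 0) (ereal 1)) (\<lambda>t. ?g t / t)"
      using set_int by simp
    have "isCont ?F t" for t using F_cont by (simp add: continuous_on_eq_continuous_at)
    then have "(?F \<longlongrightarrow> ?F t) (at t)" for t by (simp only: isCont_def)
    then have "(?F \<longlongrightarrow> ?F 0) (at_right 0)" "(?F \<longlongrightarrow> ?F 1) (at_left 1)"
      by (blast intro: filterlim_mono at_le order_refl subset_UNIV)+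
    then show "((?F \<circ> real_of_ereal) \<longlongrightarrow> ?F 0) (at_right (ereal 0))"
      "((?F \<circ> real_of_ereal) \<longlongrightarrow> ?F 1) (at_left (ereal 1))"
      by (simp_all only: ereal_tendsto_simps1)
  qed simp
  also have "(LBINT t=ereal 0..ereal 1. ?g t / t) = (LINT t|mult_haar. ?g t)"
    by (subst integral_mult_haar[OF gm]) (simp add: interval_lebesgue_integral_def)
  also have "\<dots> = (\<Sum>k\<in>{2..4*N-2}. LINT t|mult_haar. psi k (t * x) \<bullet> (\<sigma> k *v psi k (t * y)))"
    by (rule Bochner_Integration.integral_sum) (rule int)
  finally show ?thesis by (simp add: K_kernel_def Z0)
qed

end

section \<open>The kernel has finite rank\<close>

lemma continuous_on_diff_quot_coeff:
  fixes P :: "real poly"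
  assumes "continuous_on S f"
  shows "continuous_on S (\<lambda>x. diff_quot_coeff P (f x) j)"
  unfolding diff_quot_coeff_def by (intro continuous_intros assms)

lemma poly_diff_eq_diff_quot_le:
  assumes "degree P \<le> m"
  shows "poly P z - poly P t = (z - t) * (\<Sum>j<m. diff_quot_coeff P z j * t ^ j)"
proof -
  have "(\<Sum>j<m. diff_quot_coeff P z j * t ^ j) = (\<Sum>j<degree P. diff_quot_coeff P z j * t ^ j)"
    using assms by (intro sum.mono_neutral_right) (auto simp: diff_quot_coeff_def)
  then show ?thesis by (simp only: poly_diff_eq_diff_quot)
qed

text \<open>
  The quotient \<open>(a(x) b(y) - b(x) a(y)) / (x - y)\<close>, in the form \<open>((a(x) - a(y)) b(y) - (b(x) - b(y)) a(y)) / (x - y)\<close>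
  that shows it to be a sum of \<open>2 m\<close> products, provided that \<open>m\<close> bounds both degrees. This form
  also has a value on the diagonal.
\<close>

definition Christoffel_Darboux_kernel :: "real poly \<Rightarrow> real poly \<Rightarrow> nat \<Rightarrow> real \<Rightarrow> real \<Rightarrow> real" where
  "Christoffel_Darboux_kernel a b m x y =
     (\<Sum>j<m. diff_quot_coeff a x j * (y ^ j * poly b y)) - (\<Sum>j<m. diff_quot_coeff b x j * (y ^ j * poly a y))"

lemma K_kernel_wave_solution:
  assumes deg: "degree a \<le> m" "degree b \<le> m" and x: "0 < x" and y: "0 < y" and xy: "y \<noteq> x"
  shows "K_kernel (wave_solution N \<delta> a b) x y
    = sqrt x * sqrt y * (w_root N \<delta> x * w_root N \<delta> y * Christoffel_Darboux_kernel a b m x y)"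
proof -
  have pull: "(\<Sum>j<m. diff_quot_coeff P x j * y ^ j) * c = (\<Sum>j<m. diff_quot_coeff P x j * (y ^ j * c))" for P c
    by (simp add: sum_distrib_right mult.assoc)
  have "wave_solution N \<delta> a b y \<bullet> (J *v wave_solution N \<delta> a b x)
      = w_root N \<delta> x * w_root N \<delta> y
        * ((poly a x - poly a y) * poly b y - (poly b x - poly b y) * poly a y)"
    by (simp add: wave_solution_def inner_vec_def sum_2 matrix_vector_mult_22 J_def algebra_simps)
  also have "(poly a x - poly a y) * poly b y - (poly b x - poly b y) * poly a y
      = (x - y) * Christoffel_Darboux_kernel a b m x y"
    unfolding poly_diff_eq_diff_quot_le[OF deg(1)] poly_diff_eq_diff_quot_le[OF deg(2)]
      Christoffel_Darboux_kernel_def pull[symmetric]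
    by (simp add: algebra_simps)
  finally show ?thesis
    using xy by (simp add: K_kernel_def real_sqrt_mult)
qed

lemma K_kernel_sym: "K_kernel Z x y = K_kernel Z y x"
proof -
  have "Z y \<bullet> (J *v Z x) = - (Z x \<bullet> (J *v Z y))"
    by (simp add: inner_vec_def sum_2 matrix_vector_mult_22 J_def algebra_simps)
  then show ?thesis
    unfolding K_kernel_def by (metis minus_diff_eq minus_divide_divide minus_mult_right mult.commute)
qed

lemma K_kernel_diag: "K_kernel Z x x = 0"
  by (simp add: K_kernel_def)

lemma sqrt_mult_continuous_L2:
  fixes f :: "real \<Rightarrow> real"
  assumes f: "continuous_on UNIV f"
  shows "(\<lambda>x. sqrt x * f x) \<in> L2_space mult_haar"
proof -
  have "bounded (f ` {0..1})"
    by (intro compact_imp_bounded compact_continuous_image continuous_on_subset[OF f]) auto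
  then obtain c where c: "\<forall>x\<in>{0..1}. norm (f x) \<le> c" by (auto simp: bounded_iff)
  show ?thesis
  proof (rule L2_space_dominated[OF sqrt_in_L2_mult_haar, where c = c])
    have [measurable]: "f \<in> borel_measurable borel" by (rule borel_measurable_continuous_onI[OF f])
    show "(\<lambda>x. sqrt x * f x) \<in> borel_measurable mult_haar" by (rule measurable_mult_haar) measurable
    fix x :: real assume "x \<in> space mult_haar"
    then have "norm (f x) * norm (sqrt x) \<le> c * norm (sqrt x)" using c by (intro mult_right_mono) auto
    then show "norm (sqrt x * f x) \<le> c * norm (sqrt x)" by (simp add: abs_mult mult.commute)
  qed
qed

lemma K_kernel_measurable:
  assumes Z: "continuous_on UNIV Z"
  shows "(\<lambda>z. K_kernel Z (fst z) (snd z)) \<in> borel_measurable (mult_haar \<Otimes>\<^sub>M mult_haar)"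
proof (rule measurable_mult_haar_pair)
  have [measurable]: "Z \<in> borel_measurable borel" "(\<lambda>x. J *v Z x) \<in> borel_measurable borel"
    by (intro borel_measurable_continuous_onI Z
        bounded_linear.continuous_on[OF matrix_vector_mul_bounded_linear])+
  show "(\<lambda>z. K_kernel Z (fst z) (snd z)) \<in> borel_measurable (borel \<Otimes>\<^sub>M borel)"
    unfolding K_kernel_def by measurable
qed

lemma K_kernel_dominated:
  assumes deg: "degree a \<le> m" "degree b \<le> m"
  shows "\<exists>c\<ge>0. dominated_kernel mult_haar sqrt c (K_kernel (wave_solution N \<delta> a b))"
proof -
  let ?G = "\<lambda>z. w_root N \<delta> (fst z) * w_root N \<delta> (snd z) * Christoffel_Darboux_kernel a b m (fst z) (snd z)"
  have "continuous_on UNIV ?G"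
    unfolding Christoffel_Darboux_kernel_def
    by (intro continuous_intros continuous_on_diff_quot_coeff
        continuous_on_compose2[OF continuous_on_w_root]) auto
  then have "bounded (?G ` ({0..1} \<times> {0..1}))"
    by (intro compact_imp_bounded compact_continuous_image compact_Times)
      (auto intro: continuous_on_subset)
  then obtain c where c: "\<forall>z\<in>{0..1} \<times> {0..1}. norm (?G z) \<le> c" by (auto simp: bounded_iff)
  have "norm (?G (0, 0)) \<le> c" using c by (rule bspec) simp
  then have c0: "0 \<le> c" using norm_ge_zero order_trans by blast
  have "norm (K_kernel (wave_solution N \<delta> a b) x y) \<le> c * norm (sqrt x) * norm (sqrt y)"
    if xy: "0 < x" "x < 1" "0 < y" "y < 1" for x y
  proof (cases "y = x")
    case True then show ?thesis using c0 by (simp add: K_kernel_diag)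
  next
    case False
    have "norm (K_kernel (wave_solution N \<delta> a b) x y) = (norm (sqrt x) * norm (sqrt y)) * norm (?G (x, y))"
      unfolding K_kernel_wave_solution[OF deg xy(1) xy(3) False] by (simp only: norm_mult fst_conv snd_conv)
    also have "\<dots> \<le> (norm (sqrt x) * norm (sqrt y)) * c"
      using c xy by (intro mult_left_mono) auto
    finally show ?thesis by (simp add: mult_ac)
  qed
  then show ?thesis
    using c0 by (auto simp: dominated_kernel_def intro!: exI[of _ c] K_kernel_measurable continuous_on_wave_solution)
qed

lemma sum_lessThan_add: "(\<Sum>i<m + n. f i) = (\<Sum>i<m. f i) + (\<Sum>i<n. f (m + i))"
  for f :: "nat \<Rightarrow> 'a::comm_monoid_add"
  by (induction n) (simp_all add: add.assoc)

lemma K_kernel_trace_class: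
  assumes deg: "degree a \<le> m" "degree b \<le> m"
  shows "trace_class mult_haar (kernel_op mult_haar (K_kernel (wave_solution N \<delta> a b)))"
proof -
  let ?K = "K_kernel (wave_solution N \<delta> a b)" and ?w = "w_root N \<delta>"
  define l r where
    "l i x = sqrt x * (?w x * (if i < m then diff_quot_coeff a x i else diff_quot_coeff b x (i - m)))"
    and "r i y = sqrt y * (?w y * (if i < m then y ^ i * poly b y else - (y ^ (i - m) * poly a y)))"
    for i :: nat and x y :: real
  obtain c where c: "0 \<le> c" "dominated_kernel mult_haar sqrt c ?K"
    using K_kernel_dominated[OF deg] by blast
  note dom = sigma_finite_mult_haar sqrt_in_L2_mult_haar c
  have op: "kernel_op mult_haar ?K f \<in> L2_space mult_haar" if "f \<in> L2_space mult_haar" for f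
    using bounded_kernel_op_dominated[OF dom] that by (auto simp: bounded_kernel_op_def)
  show ?thesis
  proof (rule trace_class_separable_kernel[where a = r and b = l and m = "m + m"])
    show "AE y in mult_haar. y \<noteq> x" for x by (rule AE_mult_haar_neq)
    show "l i \<in> L2_space mult_haar" for i
    proof (cases "i < m")
      case True
      then show ?thesis unfolding l_def[abs_def] if_P[OF True]
        by (intro sqrt_mult_continuous_L2 continuous_intros continuous_on_w_root continuous_on_diff_quot_coeff)
    next
      case False
      then show ?thesis unfolding l_def[abs_def] if_not_P[OF False]
        by (intro sqrt_mult_continuous_L2 continuous_intros continuous_on_w_root continuous_on_diff_quot_coeff)
    qed
    show "r i \<in> L2_space mult_haar" for i
    proof (cases "i < m")
      case True
      then show ?thesis unfolding r_def[abs_def] if_P[OF True]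
        by (intro sqrt_mult_continuous_L2 continuous_intros continuous_on_w_root)
    next
      case False
      then show ?thesis unfolding r_def[abs_def] if_not_P[OF False]
        by (intro sqrt_mult_continuous_L2 continuous_intros continuous_on_w_root)
    qed
    show "(\<lambda>z. ?K (fst z) (snd z)) \<in> borel_measurable (mult_haar \<Otimes>\<^sub>M mult_haar)"
      by (rule K_kernel_measurable[OF continuous_on_wave_solution])
    fix x y assume "x \<in> space mult_haar" "y \<in> space mult_haar" and yx: "y \<noteq> x"
    then have x: "0 < x" and y: "0 < y" by auto
    have "(\<Sum>i<m + m. l i x * r i y)
        = sqrt x * sqrt y * (?w x * ?w y * (\<Sum>i<m. diff_quot_coeff a x i * (y ^ i * poly b y)))
        + sqrt x * sqrt y * (?w x * ?w y * (\<Sum>i<m. - (diff_quot_coeff b x i * (y ^ i * poly a y))))"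
      unfolding sum_lessThan_add sum_distrib_left
      by (intro arg_cong2[where f = "(+)"] sum.cong refl) (simp_all add: l_def r_def)
    also have "\<dots> = sqrt x * sqrt y * (?w x * ?w y * Christoffel_Darboux_kernel a b m x y)"
      by (simp only: Christoffel_Darboux_kernel_def sum_negf distrib_left[symmetric] diff_conv_add_uminus)
    finally show "?K x y = (\<Sum>i<m + m. l i x * r i y)"
      by (simp only: K_kernel_wave_solution[OF deg x y yx])
  qed (rule op)
qed

section \<open>The first band and the density of the equilibrium measure\<close>

text \<open>
  Hence \<open>B\<close> has no pole inside the first band, where the solution is considered. The endpoints
  from \<open>\<delta>\<^sub>2\<close> on do not decrease, and the remaining zeros lie outside of all open bands.
\<close>

lemma zeros_avoid_first_band:
  fixes \<delta> :: "nat \<Rightarrow> real"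
  assumes endpoints: "\<forall>j\<in>{1..g+1}. \<delta> (2*j-1) < \<delta> (2*j)" "\<forall>j\<in>{1..g}. \<delta> (2*j) \<le> \<delta> (2*j+1)"
    and other: "\<forall>k\<in>{2*g+3..m}. \<forall>j\<in>{1..g+1}. \<delta> k \<notin> {\<delta> (2*j-1)<..<\<delta> (2*j)}"
    and k: "k \<in> {1..m}"
  shows "\<delta> k \<notin> {\<delta> 1<..<\<delta> 2}"
proof -
  have step: "\<delta> i \<le> \<delta> (Suc i)" if "1 \<le> i" "i < 2 * g + 2" for i
  proof (cases "even i")
    case True
    then obtain j where "i = 2 * j" by blast
    with that have "i = 2 * j" "j \<in> {1..g}" by auto
    then show ?thesis using endpoints(2) by auto
  next
    case False
    then obtain j where "i = 2 * j + 1" by (rule oddE)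
    with that have "2 * (j + 1) - 1 = i" "2 * (j + 1) = Suc i" "j + 1 \<in> {1..g+1}" by auto
    then show ?thesis using endpoints(1) by (metis less_imp_le)
  qed
  have mono: "2 \<le> i \<Longrightarrow> i \<le> 2 * g + 2 \<Longrightarrow> \<delta> 2 \<le> \<delta> i" for i
  proof (induction i rule: dec_induct)
    case (step i)
    then show ?case using \<open>\<And>i. 1 \<le> i \<Longrightarrow> i < 2 * g + 2 \<Longrightarrow> \<delta> i \<le> \<delta> (Suc i)\<close>[of i] by simp
  qed simp
  consider "k = 1" | "2 \<le> k" "k \<le> 2 * g + 2" | "2 * g + 3 \<le> k" using k by fastforce
  then show ?thesis
  proof cases
    case 2 then show ?thesis using mono[of k] by auto
  next
    case 3
    then have "\<forall>j\<in>{1..g+1}. \<delta> k \<notin> {\<delta> (2*j-1)<..<\<delta> (2*j)}" using other k by auto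
    then show ?thesis by (drule_tac x = 1 in bspec) auto
  qed auto
qed

lemma AE_bounded_by_support_density:
  assumes density: "\<rho> = density lborel (\<lambda>x. ennreal (c * indicator S x * w x))"
    and meas: "(\<lambda>x. ennreal (c * indicator S x * w x)) \<in> borel_measurable lborel"
    and S: "\<And>x. x \<in> S \<Longrightarrow> \<bar>x\<bar> \<le> R"
  shows "AE x in \<rho>. \<bar>x\<bar> \<le> R"
  unfolding density AE_density[OF meas] by (auto simp: indicator_def dest: S)

lemma emeasure_finite_density_lborel:
  fixes F :: "real set"
  assumes density: "\<rho> = density lborel f" and meas: "f \<in> borel_measurable lborel" and F: "finite F"
  shows "emeasure \<rho> F = 0"
proof -
  have "F \<in> null_sets lborel" using F by (simp add: finite_imp_null_set_lborel)
  then have "AE x in lborel. x \<notin> F" by (rule AE_not_in)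
  moreover have "F \<in> sets lborel" using F by (simp add: borel_closed finite_imp_closed)
  ultimately have "F \<in> null_sets (density lborel f)"
    by (subst null_sets_density_iff[OF meas]) (auto elim: eventually_mono)
  then show ?thesis by (simp add: density null_sets_def)
qed

theorem theorem8p3:
  fixes N g n :: nat and v :: "real poly" and \<rho> :: "real measure" and \<delta> :: "nat \<Rightarrow> real"
    and p :: "nat \<Rightarrow> real poly" and \<alpha> \<beta> \<sigma> :: "nat \<Rightarrow> real^2^2" and \<kappa> :: complex
  assumes v: "N \<ge> 1" "degree v = 2 * N" "lead_coeff v > 0"
    and equilibrium: "equilibrium_measure v \<rho>"
    and support: "msupport \<rho> = (\<Union>j\<in>{1..g+1}. {\<delta> (2*j-1)..\<delta> (2*j)})"
    and endpoints: "2*g + 2 \<le> 4*N - 2" "\<forall>j\<in>{1..g+1}. \<delta> (2*j-1) < \<delta> (2*j)"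
      "\<forall>j\<in>{1..g}. \<delta> (2*j) \<le> \<delta> (2*j+1)"
    and zeros: "\<forall>z. (poly (pderiv v) z)\<^sup>2 - 4 * u_fun v \<rho> z
      = (2 * real N * lead_coeff v)\<^sup>2 * (\<Prod>j=1..4*N-2. (z - \<delta> j))"
    and other_zeros: "\<forall>k\<in>{2*g+3..4*N-2}. \<forall>j\<in>{1..g+1}. \<delta> k \<notin> {\<delta> (2*j-1)<..<\<delta> (2*j)}"
    and density: "\<rho> = density lborel
      (\<lambda>x. ennreal (1 / (2 * pi) * indicator (msupport \<rho>) x * w_fun N v \<delta> x))"
    and normalization: "\<delta> 1 = 0" "1 < \<delta> 2"
    and orthogonal: "monic_orthogonal \<rho> p"
    and n: "n \<ge> 1"
    and alpha: "residue_matrices N v \<rho> \<delta> p n \<alpha>"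
    and beta: "\<forall>j\<in>{1..4*N-2}. \<beta> j = traceless (\<alpha> j)"
    and sigma: "\<forall>k\<in>{2..4*N-2}. \<sigma> k \<in> congruence_normal_forms \<and>
      congruent_mat ((\<delta> 1 - \<delta> k) *\<^sub>R (J ** \<beta> k)) (\<sigma> k)"
    and kappa: "complex_eigenvalues (\<beta> 1) = {\<kappa>, - \<kappa>}" "2 * \<kappa> \<notin> \<int>"
  shows "\<exists>Z :: real \<Rightarrow> real^2.
    ((\<exists>x\<in>{\<delta> 1<..<\<delta> 2}. Z x \<noteq> 0) \<and>
     (\<forall>x\<in>{\<delta> 1<..<\<delta> 2}. (Z has_vector_derivative B_mat N \<delta> \<beta> x *v Z x) (at x)) \<and>
     (Z \<longlongrightarrow> 0) (at_right (\<delta> 1)))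
    \<and>
    (bounded_kernel_op mult_haar (K_kernel Z) \<and>
     trace_class mult_haar (kernel_op mult_haar (K_kernel Z)) \<and>
     (\<exists>\<psi> :: nat \<Rightarrow> real \<Rightarrow> real^2. \<exists>\<Gamma>'.
        hankel_operator {2..4*N-2} \<psi> \<and>
        is_adjoint {2..4*N-2} mult_haar (hankel \<psi>) \<Gamma>' \<and>
        (\<forall>f\<in>L2_space mult_haar. AE x in mult_haar.
           kernel_op mult_haar (K_kernel Z) f x = \<Gamma>' (\<lambda>k s. \<sigma> k *v hankel \<psi> f k s) x)))
    \<and>
    (nonneg_block_diag {2..4*N-2} \<sigma> \<longrightarrow>
     nonneg_operator mult_haar (kernel_op mult_haar (K_kernel Z)))"
proof -
  let ?I = "{1..4*N-2}" and ?K = "{2..4*N-2}"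
  let ?Q = "smult (1 / sqnorm \<rho> p (n-1)) (p (n-1))"
  define Z where "Z = wave_solution N \<delta> (p n) ?Q"
  have dens_meas: "(\<lambda>x. ennreal (1 / (2 * pi) * indicator (msupport \<rho>) x * w_fun N v \<delta> x))
      \<in> borel_measurable lborel"
  proof -
    have [measurable]: "msupport \<rho> \<in> sets borel" unfolding support by auto
    have [measurable]: "w_fun N v \<delta> \<in> borel_measurable borel"
      unfolding w_fun_def[abs_def] by (intro borel_measurable_continuous_onI continuous_intros)
    show ?thesis by measurable
  qed
  have "bounded (msupport \<rho>)" unfolding support by (rule bounded_UN) auto
  then obtain R where R: "\<And>x. x \<in> msupport \<rho> \<Longrightarrow> \<bar>x\<bar> \<le> R"
    unfolding bounded_iff real_norm_def by blast
  have "prob_space \<rho>" "sets \<rho> = sets borel"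
    using equilibrium by (simp_all add: equilibrium_measure_def finite_log_energy_def)
  moreover have "AE x in \<rho>. \<bar>x\<bar> \<le> R" by (rule AE_bounded_by_support_density[OF density dens_meas R])
  ultimately have \<rho>: "prob_space \<rho>" "sets \<rho> = sets borel" "AE x in \<rho>. \<bar>x\<bar> \<le> R" by blast+
  have h: "0 < sqnorm \<rho> p (n-1)"
    by (rule sqnorm_pos[OF \<rho> orthogonal]) (rule emeasure_finite_density_lborel[OF density dens_meas])
  have c: "2 * real N * lead_coeff v \<noteq> 0" using v by simp
  have off: "\<delta> k \<notin> {\<delta> 1<..<\<delta> 2}" if "k \<in> ?I" for k
    by (rule zeros_avoid_first_band[OF endpoints(2,3) other_zeros that])
  have pole: "x \<noteq> \<delta> j" if "x \<in> {\<delta> 1<..<\<delta> 2}" "j \<in> ?I" for x j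
    using off[OF that(2)] that(1) by blast
  have Z': "(Z has_vector_derivative B_mat N \<delta> \<beta> x *v Z x) (at x)" if x: "x \<in> {\<delta> 1<..<\<delta> 2}" for x
    unfolding Z_def
  proof (rule wave_solution_derivative[where \<alpha> = \<alpha>])
    note ctx = \<rho> orthogonal n less_imp_neq[OF h, symmetric] c alpha
    show "(\<Sum>j=1..4*N-2. trace (\<alpha> j) / (x - \<delta> j)) = - (1/2) * (\<Sum>j=1..4*N-2. 1 / (x - \<delta> j))"
      by (rule residue_trace_sum[OF ctx pole[OF x]])
    fix i :: 2
    have "(\<Sum>j=1..4*N-2. (\<alpha> j *v poly_vec (p n) ?Q x) $ i / (x - \<delta> j))
        = poly (pderiv (if i = 1 then p n else ?Q)) x"
      using first_column_equation[OF ctx pole[OF x], of i] by (simp add: matrix_vector_mult_22)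
    moreover have "i = 1 \<or> i = 2" using exhaust_2 by auto
    ultimately show "(\<Sum>j=1..4*N-2. (\<alpha> j *v poly_vec (p n) ?Q x) $ i / (x - \<delta> j))
        = poly_vec (pderiv (p n)) (pderiv ?Q) x $ i" by auto
  qed (use pole[OF x] beta in auto)
  have Z_cont: "continuous_on UNIV Z" unfolding Z_def by (rule continuous_on_wave_solution)
  have Z0: "Z 0 = 0"
    using w_root_zero[of 1 N \<delta>] v(1) normalization(1) by (simp add: Z_def wave_solution_def)
  have "(Z \<longlongrightarrow> Z 0) (at 0)"
    using Z_cont by (simp add: continuous_on_eq_continuous_at isCont_def)
  then have Z_lim: "(Z \<longlongrightarrow> 0) (at_right (\<delta> 1))"
    unfolding Z0 normalization by (rule filterlim_mono[OF _ order_refl at_le]) simp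
  \<comment> \<open>In the band, the first component of \<open>Z\<close> vanishes only at zeros of the polynomial \<open>p\<^sub>n\<close>.\<close>
  have Z_nz: "\<exists>x\<in>{\<delta> 1<..<\<delta> 2}. Z x \<noteq> 0"
  proof -
    have "p n \<noteq> 0" using p_monic[OF \<rho> orthogonal, of n] by auto
    then have "finite {x. poly (p n) x = 0}" by (rule poly_roots_finite)
    moreover have "infinite {\<delta> 1<..<\<delta> 2}" using normalization by simp
    ultimately obtain x where x: "x \<in> {\<delta> 1<..<\<delta> 2}" "poly (p n) x \<noteq> 0"
      by (metis (mono_tags, lifting) finite_subset mem_Collect_eq subsetI)
    have "0 < w_root N \<delta> x" by (rule w_root_pos) (rule pole[OF x(1)])
    then have "Z x $ 1 \<noteq> 0"
      using x(2) by (simp add: Z_def wave_solution_def)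
    then have "Z x \<noteq> 0" by auto
    then show ?thesis using x by blast
  qed
  have "\<forall>k\<in>?K. \<exists>C. (- \<delta> k) *\<^sub>R (J ** \<beta> k) = transpose C ** \<sigma> k ** C"
    using sigma unfolding congruent_mat_def normalization(1) diff_0 by blast
  then obtain C where C: "\<And>k. k \<in> ?K \<Longrightarrow> (- \<delta> k) *\<^sub>R (J ** \<beta> k) = transpose (C k) ** \<sigma> k ** C k"
    by metis
  let ?\<psi> = "hankel_symbol \<delta> C Z"
  \<comment> \<open>As \<open>\<delta>\<^sub>2 > 1\<close>, the unit interval keeps away from the right end of the band.\<close>
  have unit: "\<delta> j \<notin> {0<..1}" if "j \<in> ?I" for j
    using off[OF that] normalization by auto
  have trace_0: "trace (\<beta> j) = 0" if "j \<in> ?I" for j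
    using beta that by (simp add: trace_traceless)
  have Z'_unit: "(Z has_vector_derivative B_mat N \<delta> \<beta> x *v Z x) (at x)" if "0 < x" "x < 1" for x
    using that normalization by (intro Z') auto
  note ctx = normalization(1) unit trace_0 Z'_unit Z_cont Z0 C
  obtain B where B: "0 \<le> B" "\<And>k x. k \<in> ?K \<Longrightarrow> 0 < x \<Longrightarrow> x < 1 \<Longrightarrow> norm (?\<psi> k x) \<le> B * sqrt x"
    using hankel_symbol_bounded[OF ctx] by blast
  note hank = B(1) hankel_symbol_measurable[OF ctx] B(2)
  have deg: "degree (p n) \<le> n" "degree ?Q \<le> n"
    using p_degree[OF \<rho> orthogonal] by (auto intro: order_trans[OF degree_smult_le])
  obtain A where A: "0 \<le> A" "dominated_kernel mult_haar sqrt A (K_kernel Z)"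
    using K_kernel_dominated[OF deg] unfolding Z_def by blast
  note dom = sigma_finite_mult_haar sqrt_in_L2_mult_haar A
  have adj: "is_adjoint ?K mult_haar (hankel ?\<psi>) (hankel_adjoint ?K ?\<psi>)"
    by (rule is_adjoint_hankel_adjoint[OF hank])
  have product: "kernel_op mult_haar (K_kernel Z) f x
      = hankel_adjoint ?K ?\<psi> (\<lambda>k s. \<sigma> k *v hankel ?\<psi> f k s) x"
    if "f \<in> L2_space mult_haar" "x \<in> space mult_haar" for f x
    using that
    by (intro kernel_op_eq_hankel_product[OF hank] kernel_eq_symbol_integral[OF ctx]
        K_kernel_measurable[OF Z_cont]) auto
  have nonneg: "nonneg_operator mult_haar (kernel_op mult_haar (K_kernel Z))"
    if \<sigma>: "nonneg_block_diag ?K \<sigma>"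
    unfolding nonneg_operator_def
  proof (intro conjI ballI)
    fix f g :: "real \<Rightarrow> real" assume f: "f \<in> L2_space mult_haar" and g: "g \<in> L2_space mult_haar"
    show "L2_inner mult_haar (kernel_op mult_haar (K_kernel Z) f) g
        = L2_inner mult_haar f (kernel_op mult_haar (K_kernel Z) g)"
      by (rule symmetric_kernel_op[OF dom K_kernel_sym f g])
  next
    fix f :: "real \<Rightarrow> real" assume f: "f \<in> L2_space mult_haar"
    let ?F = "\<lambda>k s. \<sigma> k *v hankel ?\<psi> f k s"
    have "?F \<in> L2_blocks ?K mult_haar"
      unfolding L2_blocks_def mem_Collect_eq
      by (intro ballI L2_space_bounded_linear[OF matrix_vector_mul_bounded_linear])
        (rule hankel_L2[OF hank _ f])
    then have "L2_blocks_inner ?K mult_haar (hankel ?\<psi> f) ?F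
        = L2_inner mult_haar f (hankel_adjoint ?K ?\<psi> ?F)"
      using adj f by (simp add: is_adjoint_def)
    also have "\<dots> = L2_inner mult_haar (kernel_op mult_haar (K_kernel Z) f) f"
      unfolding L2_inner_def
      by (rule Bochner_Integration.integral_cong) (use product[OF f] in \<open>simp_all add: inner_commute\<close>)
    finally show "0 \<le> L2_inner mult_haar (kernel_op mult_haar (K_kernel Z) f) f"
      using nonneg_block_diag_imp_nonneg_form[OF finite_atLeastAtMost \<sigma>, of ?\<psi> f] by simp
  qed
  show ?thesis
  proof (intro exI[of _ Z] conjI impI ballI)
    show "bounded_kernel_op mult_haar (K_kernel Z)" by (rule bounded_kernel_op_dominated[OF dom])
    show "trace_class mult_haar (kernel_op mult_haar (K_kernel Z))"
      unfolding Z_def by (rule K_kernel_trace_class[OF deg])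
    show "\<exists>\<psi> \<Gamma>'. hankel_operator ?K \<psi> \<and> is_adjoint ?K mult_haar (hankel \<psi>) \<Gamma>' \<and>
        (\<forall>f\<in>L2_space mult_haar. AE x in mult_haar.
           kernel_op mult_haar (K_kernel Z) f x = \<Gamma>' (\<lambda>k s. \<sigma> k *v hankel \<psi> f k s) x)"
      using hankel_operator_sqrt_bound[OF hank hankel_symbol_continuous[OF ctx]] adj product
      by (intro exI[of _ ?\<psi>] exI[of _ "hankel_adjoint ?K ?\<psi>"] conjI ballI AE_I2)
  qed (use Z_nz Z' Z_lim nonneg in auto)
qed

end
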